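(* The synchronous correlation set $C_q^s(5,2)$ is not a closed subset of $\mathbb{R}^{100}$.
   Context: A projection valued measure (PVM) on a Hilbert space $\mathcal H$ is a finite family $\{P_i\}_{i=1}^k$ of (orthogonal) projections on $\mathcal H$ with $\sum_{i=1}^k P_i = I$. For $n,k\in\mathbb N$, the set $C_q(n,k)\subseteq\mathbb R^{n^2k^2}$ of quantum correlations is the set of all tuples $(p(i,j|v,w))$, $1\le v,w\le n$, $1\le i,j\le k$, for which there exist finite dimensional Hilbert spaces $\mathcal H_A,\mathcal H_B$, PVMs $\{P_{v,i}\}_{i=1}^k$ on $\mathcal H_A$ (one for each $1\le v\le n$), PVMs $\{Q_{w,j}\}_{j=1}^k$ on $\mathcal H_B$ (one for each $1\le w\le n$), and a unit vector $h\in\mathcal H_A\otimes\mathcal H_B$ such that $p(i,j|v,w)=\langle (P_{v,i}\otimes Q_{w,j})h,h\rangle$ for all $i,j,v,w$. A tuple $(p(i,j|v,w))$ is called synchronous if $p(i,j|v,v)=0$ for all $v$ and all $i\ne j$. $C_q^s(n,k)$ denotes the set of synchronous elements of $C_q(n,k)$. *)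

theory Defs
  imports "HOL-Analysis.Analysis" "Jordan_Normal_Form.Schur_Decomposition"
begin

text \<open>
  Finite dimensional Hilbert spaces are taken to be \<open>\<complex>\<^sup>d\<close> for a natural number \<open>d\<close>, with vectors
  and operators in \<^term>\<open>carrier_vec d\<close> and \<^term>\<open>carrier_mat d d\<close>; the dimension has to be a term
  since it is existentially quantified below. The inner product is
  \<open>v \<bullet>c w = (\<Sum>i. v\<^sub>i * cnj w\<^sub>i)\<close>, linear in the first argument.
\<close>

definition orthogonal_projection :: "nat \<Rightarrow> complex mat \<Rightarrow> bool" where
  "orthogonal_projection d P \<longleftrightarrow>
     P \<in> carrier_mat d d \<and> mat_adjoint P = P \<and> P * P = P"

text \<open>
  Matrices of unspecified dimension do not form a commutative monoid, so the condition
  \<open>\<Sum>\<^sub>i P\<^sub>i = I\<close> is written with the sum taken entrywise.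
\<close>

definition PVM :: "nat \<Rightarrow> ('k::finite \<Rightarrow> complex mat) \<Rightarrow> bool" where
  "PVM d P \<longleftrightarrow>
     (\<forall>i. orthogonal_projection d (P i)) \<and>
     mat d d (\<lambda>(r, s). \<Sum>i\<in>UNIV. P i $$ (r, s)) = 1\<^sub>m d"

text \<open>
  The Kronecker product. It is the operator \<open>A \<otimes> B\<close> under the identification
  \<open>\<complex>\<^sup>a \<otimes> \<complex>\<^sup>b = \<complex>\<^sup>a\<^sup>b\<close>, \<open>e\<^sub>r \<otimes> e\<^sub>s = e\<^sub>t\<close> with \<open>t = r * b + s\<close> (indices from \<open>0\<close>).
\<close>

definition kronecker :: "complex mat \<Rightarrow> complex mat \<Rightarrow> complex mat" where
  "kronecker A B =
     mat (dim_row A * dim_row B) (dim_col A * dim_col B)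
       (\<lambda>(r, s). A $$ (r div dim_row B, s div dim_col B) *
                 B $$ (r mod dim_row B, s mod dim_col B))"

text \<open>
  The types \<open>'n\<close> and \<open>'k\<close> stand for the sets of \<open>n\<close> inputs and \<open>k\<close> outputs. The coordinate
  \<open>(i, j, v, w)\<close> of a point of \<open>\<real>\<^sup>N\<close>, \<open>N = n\<^sup>2 k\<^sup>2\<close>, is \<open>p(i, j | v, w)\<close>.
\<close>

definition quantum_correlations :: "(real ^ ('k::finite \<times> 'k \<times> 'n::finite \<times> 'n)) set" where
  "quantum_correlations =
     {p. \<exists>a b (P :: 'n \<Rightarrow> 'k \<Rightarrow> complex mat) (Q :: 'n \<Rightarrow> 'k \<Rightarrow> complex mat) h.
        (\<forall>v. PVM a (P v)) \<and> (\<forall>w. PVM b (Q w)) \<and>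
        h \<in> carrier_vec (a * b) \<and> h \<bullet>c h = 1 \<and>
        (\<forall>i j v w. complex_of_real (vec_nth p (i, j, v, w)) =
           (kronecker (P v i) (Q w j) *\<^sub>v h) \<bullet>c h)}"

definition synchronous :: "real ^ ('k::finite \<times> 'k \<times> 'n::finite \<times> 'n) \<Rightarrow> bool" where
  "synchronous p \<longleftrightarrow> (\<forall>v i j. i \<noteq> j \<longrightarrow> vec_nth p (i, j, v, v) = 0)"

definition synchronous_quantum_correlations ::
    "(real ^ ('k::finite \<times> 'k \<times> 'n::finite \<times> 'n)) set" where
  "synchronous_quantum_correlations = {p \<in> quantum_correlations. synchronous p}"

end

theory Submission
  imports Defs
begin

text \<open>
  For irrational \<open>\<lambda>\<close> no five projections on a nonzero finite dimensional space sum to \<open>\<lambda> I\<close>, since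
  the trace would make \<open>\<lambda>\<close> rational. On the other hand, for \<open>\<lambda> = 2 + \<theta>\<close> with \<open>0 < \<theta> < 1\<close> there are
  five projections on \<open>\<complex>\<^sup>d\<close>, built from \<open>2 \<times> 2\<close> blocks along a path, whose sum differs from \<open>\<lambda> I\<close>
  only in two diagonal entries. The continuous function
  \<open>f(p) = \<Sum>\<^sub>v\<^sub>,\<^sub>w p(1,1|v,w) - 2\<lambda> \<Sum>\<^sub>v p(1,1|v,v) + \<lambda>\<^sup>2\<close> therefore takes arbitrarily small values on the
  correlations \<open>p(i,j|v,w) = tr(P\<^sub>v\<^sub>,\<^sub>i P\<^sub>w\<^sub>,\<^sub>j) / d\<close>, and if the synchronous correlations were closed,
  compactness would give a synchronous \<open>p\<close> with \<open>f(p) \<le> 0\<close>. Reading the unit vector of its model as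
  a matrix \<open>H\<close>, synchronicity means \<open>P\<^sub>v H = H Q\<^sub>v\<^sup>T\<close>, and \<open>f(p)\<close> is the squared Frobenius norm of
  \<open>(\<Sum>\<^sub>v P\<^sub>v) H - \<lambda> H\<close>. Hence the range of \<open>H\<close> is invariant under all \<open>P\<^sub>v\<close>, which sum to \<open>\<lambda>\<close> on it,
  contradicting the irrationality of \<open>\<lambda>\<close>.
\<close>

section \<open>Traces of intertwined idempotents\<close>

definition mtrace :: "complex mat \<Rightarrow> complex" where
  "mtrace A = (\<Sum>i<dim_row A. A $$ (i, i))"

lemma index_mult_mat_sum:
  assumes "A \<in> carrier_mat m n" "B \<in> carrier_mat n k" "i < m" "j < k"
  shows "(A * B) $$ (i, j) = (\<Sum>t<n. A $$ (i, t) * B $$ (t, j))"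
  using assms by (simp add: scalar_prod_def atLeast0LessThan)

lemma mtrace_mult_commute:
  assumes "A \<in> carrier_mat m n" "B \<in> carrier_mat n m"
  shows "mtrace (A * B) = mtrace (B * A)"
proof -
  have "mtrace (A * B) = (\<Sum>i<m. \<Sum>t<n. A $$ (i, t) * B $$ (t, i))"
    using assms by (auto simp: mtrace_def index_mult_mat_sum simp del: index_mult_mat(1) intro!: sum.cong)
  also have "\<dots> = (\<Sum>t<n. \<Sum>i<m. B $$ (t, i) * A $$ (i, t))"
    by (subst sum.swap) (simp add: mult.commute)
  also have "\<dots> = mtrace (B * A)"
    using assms by (auto simp: mtrace_def index_mult_mat_sum simp del: index_mult_mat(1) intro!: sum.cong)
  finally show ?thesis .
qed

lemma mtrace_add:
  assumes "A \<in> carrier_mat n n" "B \<in> carrier_mat n n"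
  shows "mtrace (A + B) = mtrace A + mtrace B"
  using assms by (simp add: mtrace_def sum.distrib)

text \<open>Schur triangularization gives a similar upper triangular idempotent, whose diagonal
  entries are 0 or 1; the trace counts the ones. The bound by \<open>n\<close> later limits an
  iteration on traces.\<close>

lemma idempotent_mtrace:
  assumes E: "E \<in> carrier_mat n n" and EE: "E * E = E"
  obtains k :: nat where "k \<le> n" "mtrace E = of_nat k"
proof -
  obtain es where "char_poly E = (\<Prod>e\<leftarrow>es. [:- e, 1:])"
    using char_poly_factorized[OF E] by auto
  then obtain B where B: "B \<in> carrier_mat n n" "upper_triangular B" "similar_mat E B"
    using schur_decomposition_exists[OF E] by blast
  then obtain P Q where PQ: "similar_mat_wit E B P Q"
    by (auto simp: similar_mat_def)
  note w = similar_mat_witD2[OF E PQ]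
  have B_eq: "B = Q * E * P"
    using similar_mat_witD2[OF B(1) similar_mat_wit_sym[OF PQ]] by simp
  have "B * B = Q * E * (P * Q) * (E * P)"
    unfolding B_eq using w(6,7) E by (simp add: assoc_mult_mat[of _ n n _ n _ n])
  also have "\<dots> = Q * (E * E) * P"
    unfolding w(1) using w(6,7) E by (simp add: assoc_mult_mat[of _ n n _ n _ n])
  finally have BB: "B * B = B" using EE B_eq by simp
  have diag: "B $$ (i, i) \<in> {0, 1}" if i: "i < n" for i
  proof -
    have "B $$ (i, i) = (\<Sum>t<n. B $$ (i, t) * B $$ (t, i))"
      using index_mult_mat_sum[OF B(1) B(1) i i] BB by simp
    \<comment> \<open>For \<open>t < i\<close> the first factor lies below the diagonal, for
      \<open>t > i\<close> the second one does.\<close>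
    also have "\<dots> = (\<Sum>t<n. if t = i then B $$ (i, i) * B $$ (i, i) else 0)"
      using B(1,2) i by (intro sum.cong) (auto simp: upper_triangular_def neq_iff)
    also have "\<dots> = B $$ (i, i) * B $$ (i, i)"
      using i by simp
    finally show ?thesis
      by (metis insertCI mult_cancel_right1)
  qed
  have "mtrace E = mtrace (P * (B * Q))"
    using w by (simp add: assoc_mult_mat[of _ n n _ n _ n])
  also have "\<dots> = mtrace (B * Q * P)"
    using w by (subst mtrace_mult_commute[of _ n n]) auto
  also have "\<dots> = mtrace B"
    using w by (simp add: assoc_mult_mat[of _ n n _ n _ n])
  also have "\<dots> = (\<Sum>i<n. if B $$ (i, i) = 1 then 1 else 0)"
    using diag B(1) unfolding mtrace_def by (intro sum.cong) auto
  also have "\<dots> = of_nat (card {i. i < n \<and> B $$ (i, i) = 1})"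
    by (simp add: sum.If_cases Int_def)
  finally have "mtrace E = of_nat (card {i. i < n \<and> B $$ (i, i) = 1})" .
  moreover have "card {i. i < n \<and> B $$ (i, i) = 1} \<le> n"
    using card_mono[of "{..<n}" "{i. i < n \<and> B $$ (i, i) = 1}"] by auto
  ultimately show ?thesis using that by blast
qed

section \<open>Outer inverses of maximal trace\<close>

lemma minus_r_zero_mat:
  "A \<in> carrier_mat n m \<Longrightarrow> A - 0\<^sub>m n m = (A :: 'a :: group_add mat)"
  by (intro eq_matI) auto

text \<open>
  The new outer inverse is \<open>G + (1 - GH) Z (1 - HG)\<close>, where \<open>Z\<close> is a matrix unit scaled so that
  \<open>Z E Z = Z\<close> for \<open>E = H - HGH\<close>. Iterating this step until \<open>HGH = H\<close> avoids rank factorizations.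
\<close>

lemma outer_inverse_extend:
  assumes H: "H \<in> carrier_mat a b" and G: "G \<in> carrier_mat b a"
    and GHG: "G * H * G = G" and ne: "H * G * H \<noteq> H"
  obtains G' where "G' \<in> carrier_mat b a" "G' * H * G' = G'" "mtrace (H * G') = mtrace (H * G) + 1"
proof -
  \<comment> \<open>\<open>K\<close> and \<open>L\<close> are idempotent because
    \<open>G * H * G = G\<close>, and \<open>M\<close>, \<open>N\<close> are their complements. The
    residue \<open>E = H - H * G * H\<close> equals both \<open>H * M\<close> and
    \<open>N * H\<close>, so it absorbs \<open>N\<close> on the left and \<open>M\<close> on the
    right.\<close>
  define K where "K = G * H"
  define L where "L = H * G"
  define M where "M = 1\<^sub>m b - K"
  define N where "N = 1\<^sub>m a - L"
  define E where "E = H * M"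
  have K: "K \<in> carrier_mat b b" and L: "L \<in> carrier_mat a a"
    using H G by (auto simp: K_def L_def)
  then have M: "M \<in> carrier_mat b b" and N: "N \<in> carrier_mat a a"
    by (auto simp: M_def N_def)
  have E: "E \<in> carrier_mat a b"
    using H M by (auto simp: E_def)
  have KG: "K * G = G" using GHG by (simp add: K_def)
  have GL: "G * L = G" using GHG assoc_mult_mat[OF G H G] by (simp add: L_def)
  have KK: "K * K = K"
    using assoc_mult_mat[OF K G H] by (simp only: KG K_def[symmetric])
  have LL: "L * L = L"
    using assoc_mult_mat[OF H G L] by (simp only: GL L_def[symmetric])
  have HK: "H * K = L * H"
    using assoc_mult_mat[OF H G H] by (simp add: K_def L_def)
  have KM: "K * M = 0\<^sub>m b b" and MK: "M * K = 0\<^sub>m b b"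
    using mult_minus_distrib_mat[OF K one_carrier_mat K] minus_mult_distrib_mat[OF one_carrier_mat K K] K
    by (simp_all add: M_def KK)
  have NL: "N * L = 0\<^sub>m a a" and LN: "L * N = 0\<^sub>m a a"
    using mult_minus_distrib_mat[OF L one_carrier_mat L] minus_mult_distrib_mat[OF one_carrier_mat L L] L
    by (simp_all add: N_def LL)
  have E_eq: "E = H - L * H"
    using mult_minus_distrib_mat[OF H one_carrier_mat K] H by (simp add: E_def M_def HK)
  have NH: "N * H = E"
    using minus_mult_distrib_mat[OF one_carrier_mat L H] H by (simp add: E_eq N_def)
  have LE: "L * E = 0\<^sub>m a b"
    using assoc_mult_mat[OF L N H] H by (simp add: NH LN)
  have NE: "N * E = E"
    using minus_mult_distrib_mat[OF one_carrier_mat L E] E minus_r_zero_mat[OF E]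
    by (simp add: N_def LE)
  have EK: "E * K = 0\<^sub>m a b"
    using assoc_mult_mat[OF H M K] H by (simp add: E_def MK)
  have EM: "E * M = E"
    using mult_minus_distrib_mat[OF E one_carrier_mat K] E minus_r_zero_mat[OF E]
    by (simp add: M_def EK)
  have "\<exists>i<a. \<exists>j<b. E $$ (i, j) \<noteq> 0"
  proof (rule ccontr)
    assume "\<not> ?thesis"
    then have *: "E $$ (i, j) = 0" if "i < a" "j < b" for i j using that by blast
    have "(L * H) $$ (i, j) = H $$ (i, j)" if "i < a" "j < b" for i j
      using *[OF that] that H L by (simp add: E_eq del: index_mult_mat(1))
    then have "L * H = H" using H L by (intro eq_matI) auto
    with ne show False by (simp add: L_def)
  qed
  then obtain i j where ij: "i < a" "j < b" "E $$ (i, j) \<noteq> 0" by blast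
  define Z where "Z = mat b a (\<lambda>(r, s). if r = j \<and> s = i then 1 / E $$ (i, j) else 0)"
  have Z: "Z \<in> carrier_mat b a" by (simp add: Z_def)
  have EZc: "E * Z \<in> carrier_mat a a" and ZN: "Z * N \<in> carrier_mat b a"
    using E Z N M by auto
  have EZ: "(E * Z) $$ (r, s) = (if s = i then E $$ (r, j) / E $$ (i, j) else 0)" if "r < a" "s < a" for r s
  proof -
    have "(E * Z) $$ (r, s) = (\<Sum>t<b. if t = j then (if s = i then E $$ (r, j) / E $$ (i, j) else 0) else 0)"
      unfolding index_mult_mat_sum[OF E Z that] using that ij by (intro sum.cong) (auto simp: Z_def)
    then show ?thesis using ij by simp
  qed
  have ZEZ: "Z * (E * Z) = Z"
  proof (rule eq_matI)
    fix r s assume "r < dim_row Z" "s < dim_col Z"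
    then have rs: "r < b" "s < a" using Z by auto
    have "(Z * (E * Z)) $$ (r, s) = (\<Sum>t<a. Z $$ (r, t) * (E * Z) $$ (t, s))"
      by (rule index_mult_mat_sum[OF Z EZc rs])
    also have "\<dots> = (\<Sum>t<a. if t = i then Z $$ (r, i) * (if s = i then 1 else 0) else 0)"
    proof (intro sum.cong refl)
      fix t assume "t \<in> {..<a}"
      then have t: "t < a" by simp
      have "Z $$ (r, t) = (if t = i then Z $$ (r, i) else 0)"
        using t rs ij(1) by (simp add: Z_def)
      then show "Z $$ (r, t) * (E * Z) $$ (t, s) = (if t = i then Z $$ (r, i) * (if s = i then 1 else 0) else 0)"
        unfolding EZ[OF t rs(2)] using ij(3) by simp
    qed
    also have "\<dots> = Z $$ (r, s)" using rs ij by (auto simp: Z_def)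
    finally show "(Z * (E * Z)) $$ (r, s) = Z $$ (r, s)" .
  qed (use Z E in auto)
  \<comment> \<open>The factors \<open>M\<close> and \<open>N\<close> give \<open>K * U = 0\<close>
    and \<open>U * L = 0\<close>, so the cross terms vanish when
    \<open>(G + U) * H * (G + U)\<close> is expanded, leaving \<open>G * H * G\<close> and
    \<open>U * H * U\<close>.\<close>
  define U where "U = M * (Z * N)"
  have U: "U \<in> carrier_mat b a" using M ZN by (auto simp: U_def)
  have HU: "H * U = E * (Z * N)"
    using assoc_mult_mat[OF H M ZN] by (simp add: U_def E_def)
  have KU: "K * U = 0\<^sub>m b a"
    using assoc_mult_mat[OF K M ZN] left_mult_zero_mat[OF ZN] by (simp add: U_def KM)
  have UL: "U * L = 0\<^sub>m b a"
    using assoc_mult_mat[OF M ZN L] assoc_mult_mat[OF Z N L]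
      right_mult_zero_mat[OF Z] right_mult_zero_mat[OF M] by (simp add: U_def NL)
  have EZN: "E * (Z * N) \<in> carrier_mat a a" using E ZN by auto
  have "U * (H * U) = M * ((Z * N) * (E * (Z * N)))"
    unfolding HU unfolding U_def by (rule assoc_mult_mat[OF M ZN EZN])
  also have "(Z * N) * (E * (Z * N)) = Z * (N * (E * (Z * N)))"
    using E ZN by (intro assoc_mult_mat[OF Z N]) auto
  also have "N * (E * (Z * N)) = (E * Z) * N"
    using assoc_mult_mat[OF N E ZN] assoc_mult_mat[OF E Z N] by (simp add: NE)
  also have "Z * ((E * Z) * N) = Z * N"
    using assoc_mult_mat[OF Z EZc N] by (simp add: ZEZ)
  finally have UHU: "U * (H * U) = U" by (simp add: U_def)
  have GU: "G + U \<in> carrier_mat b a" and HUc: "H * U \<in> carrier_mat a a"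
    using G U H by auto
  have HGU: "H * (G + U) = L + H * U"
    using mult_add_distrib_mat[OF H G U] by (simp add: L_def)
  have GHU: "G * (H * U) = 0\<^sub>m b a"
    using assoc_mult_mat[OF G H U] KU by (simp add: K_def)
  have "(G + U) * H * (G + U) = (G + U) * (L + H * U)"
    using assoc_mult_mat[OF GU H GU] by (simp add: HGU)
  also have "\<dots> = (G + U) * L + (G + U) * (H * U)"
    by (rule mult_add_distrib_mat[OF GU L HUc])
  also have "(G + U) * L = G"
    using add_mult_distrib_mat[OF G U L] G by (simp add: GL UL)
  also have "(G + U) * (H * U) = U"
    using add_mult_distrib_mat[OF G U HUc] U by (simp add: GHU UHU)
  finally have "(G + U) * H * (G + U) = G + U" .
  moreover have "mtrace (H * (G + U)) = mtrace (H * G) + 1"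
  proof -
    \<comment> \<open>Cyclicity moves \<open>N\<close> to the left, where \<open>E\<close> absorbs
      it. The product \<open>E * Z\<close> has only column \<open>i\<close> nonzero, with diagonal
      entry 1.\<close>
    have "mtrace (H * U) = mtrace (E * Z * N)"
      using assoc_mult_mat[OF E Z N] by (simp add: HU)
    also have "\<dots> = mtrace (N * (E * Z))"
      by (rule mtrace_mult_commute[OF EZc N])
    also have "N * (E * Z) = E * Z"
      using assoc_mult_mat[OF N E Z] by (simp add: NE)
    also have "mtrace (E * Z) = (\<Sum>r<a. if r = i then 1 else 0)"
      unfolding mtrace_def using E ij
      by (intro sum.cong) (auto simp: EZ simp del: index_mult_mat(1))
    also have "\<dots> = 1" using ij by simp
    finally show ?thesis
      using mtrace_add[OF L HUc] by (simp add: HGU L_def)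
  qed
  ultimately show ?thesis using that[of "G + U"] GU by auto
qed

text \<open>For an outer inverse \<open>G\<close> the product \<open>H * G\<close> is idempotent, so
  its trace is a natural number at most \<open>a\<close>. An outer inverse of greatest trace cannot
  be extended, which forces \<open>H * G * H = H\<close>.\<close>

lemma generalized_inverse_exists:
  assumes H: "H \<in> carrier_mat a b" and ne: "H \<noteq> 0\<^sub>m a b"
  obtains G where "G \<in> carrier_mat b a" "H * G * H = H" "mtrace (H * G) \<noteq> 0"
proof -
  define K where "K k \<longleftrightarrow> (\<exists>G \<in> carrier_mat b a. G * H * G = G \<and> mtrace (H * G) = of_nat k)" for k :: nat
  have bound: "k \<le> a" if k: "K k" for k
  proof -
    from k[unfolded K_def] obtain G where G: "G \<in> carrier_mat b a"
      and GHG: "G * H * G = G \<and> mtrace (H * G) = of_nat k"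
      by (rule bexE)
    have HG: "H * G \<in> carrier_mat a a" using H G by auto
    have "H * G * (H * G) = H * G"
      unfolding assoc_mult_mat[OF H G HG] using GHG[unfolded assoc_mult_mat[OF G H G]] by argo
    from idempotent_mtrace[OF HG this] obtain k' where "k' \<le> a" "mtrace (H * G) = of_nat k'"
      by auto
    then show ?thesis using GHG by simp
  qed
  have step: "K (Suc k)"
    if G: "G \<in> carrier_mat b a" and GHG: "G * H * G = G" and tr: "mtrace (H * G) = of_nat k"
      and ne: "H * G * H \<noteq> H" for k G
  proof -
    obtain G' where G': "G' \<in> carrier_mat b a" "G' * H * G' = G'"
      "mtrace (H * G') = mtrace (H * G) + 1"
      by (rule outer_inverse_extend[OF H G GHG ne])
    then have "mtrace (H * G') = of_nat (Suc k)"
      using tr by simp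
    with G' show ?thesis
      unfolding K_def by (intro bexI conjI)
  qed
  \<comment> \<open>The zero matrix is an outer inverse of trace 0, and \<open>H\<close> being
    nonzero allows one extension; hence the greatest trace is positive.\<close>
  have K1: "K (Suc 0)"
  proof (rule step)
    show "H * 0\<^sub>m b a * H \<noteq> H" using H ne by simp
  qed (use H in \<open>simp_all add: mtrace_def\<close>)
  define k where "k = (GREATEST k. K k)"
  have "K k" unfolding k_def
    by (rule GreatestI_nat[of K "Suc 0" a, OF K1]) (use bound in auto)
  have max: "l \<le> k" if "K l" for l unfolding k_def
    by (rule Greatest_le_nat[of K _ a, OF that]) (use bound in auto)
  from \<open>K k\<close>[unfolded K_def] obtain G where G: "G \<in> carrier_mat b a"
    and GHG: "G * H * G = G \<and> mtrace (H * G) = of_nat k"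
    by (rule bexE)
  have "H * G * H = H"
    using step[OF G GHG[THEN conjunct1] GHG[THEN conjunct2]] max[of "Suc k"] by linarith
  moreover have "mtrace (H * G) \<noteq> 0"
    using GHG max[OF K1] by auto
  ultimately show ?thesis using that[OF G] by simp
qed

text \<open>
  With \<open>\<Pi> = HG\<close> the products \<open>P\<^sub>v \<Pi>\<close> are idempotents with \<open>(\<Sum>\<^sub>v P\<^sub>v) \<Pi> = c \<Pi>\<close>. As idempotents have
  integer traces, taking traces exhibits \<open>c\<close> as a quotient of integers.
\<close>

lemma intertwined_idempotents_rational:
  fixes P R :: "'n::finite \<Rightarrow> complex mat"
  assumes H: "H \<in> carrier_mat a b" and ne: "H \<noteq> 0\<^sub>m a b"
    and P: "\<And>v. P v \<in> carrier_mat a a" and PP: "\<And>v. P v * P v = P v"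
    and R: "\<And>v. R v \<in> carrier_mat b b" and PH: "\<And>v. P v * H = H * R v"
    and sum: "\<And>r s. r < a \<Longrightarrow> s < b \<Longrightarrow> (\<Sum>v\<in>UNIV. (P v * H) $$ (r, s)) = c * H $$ (r, s)"
  shows "c \<in> \<rat>"
proof -
  obtain G where G: "G \<in> carrier_mat b a" and HGH: "H * G * H = H" and tr: "mtrace (H * G) \<noteq> 0"
    by (rule generalized_inverse_exists[OF H ne])
  have HG: "H * G \<in> carrier_mat a a" using H G by auto
  have "H * G * (H * G) = H * G"
    using assoc_mult_mat[OF HG H G] HGH by simp
  from idempotent_mtrace[OF _ this] have "mtrace (H * G) \<in> \<rat>"
    using H G by (metis Rats_of_nat mult_carrier_mat)
  moreover have "mtrace (P v * H * G) \<in> \<rat>" for v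
  proof -
    have X: "P v * H \<in> carrier_mat a b" and XG: "P v * H * G \<in> carrier_mat a a"
      using P[of v] H G by auto
    \<comment> \<open>Intertwining puts the columns of \<open>P v * H\<close> into the range of
      \<open>H\<close>, on which \<open>H * G\<close> is the identity.\<close>
    have "H * G * (P v * H) = P v * H"
      unfolding PH using assoc_mult_mat[OF HG H R[of v]] HGH by simp
    then have absorb: "H * G * (P v * H * G) = P v * H * G"
      using assoc_mult_mat[OF HG X G] by simp
    have "P v * H * G * (P v * H * G) = P v * (H * G * (P v * H * G))"
      using assoc_mult_mat[OF P H G, of v] assoc_mult_mat[OF P HG XG, of v] by simp
    also have "\<dots> = P v * (P v * (H * G))"
      unfolding absorb using assoc_mult_mat[OF P H G, of v] by simp
    also have "\<dots> = P v * H * G"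
      using assoc_mult_mat[OF P P HG, of v v] assoc_mult_mat[OF P H G, of v] PP[of v] by simp
    finally show ?thesis
      using idempotent_mtrace[of "P v * H * G" a] H G P[of v]
      by (metis Rats_of_nat mult_carrier_mat)
  qed
  then have "(\<Sum>v\<in>UNIV. mtrace (P v * H * G)) \<in> \<rat>" by (intro Rats_sum)
  moreover have "(\<Sum>v\<in>UNIV. mtrace (P v * H * G)) = c * mtrace (H * G)"
  proof -
    have "mtrace (P v * H * G) = (\<Sum>r<a. \<Sum>t<b. (P v * H) $$ (r, t) * G $$ (t, r))" for v
    proof -
      have "P v * H \<in> carrier_mat a b" using P[of v] H by auto
      from index_mult_mat_sum[OF this G] show ?thesis
        using P[of v] by (simp add: mtrace_def del: index_mult_mat(1))
    qed
    then have "(\<Sum>v\<in>UNIV. mtrace (P v * H * G)) = (\<Sum>r<a. \<Sum>t<b. (\<Sum>v\<in>UNIV. (P v * H) $$ (r, t)) * G $$ (t, r))"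
      by (simp add: sum.swap[of _ _ UNIV] sum_distrib_right)
    also have "\<dots> = (\<Sum>r<a. \<Sum>t<b. c * H $$ (r, t) * G $$ (t, r))"
      by (simp add: sum del: index_mult_mat(1))
    also have "\<dots> = c * mtrace (H * G)"
      using H index_mult_mat_sum[OF H G] by (simp add: mtrace_def sum_distrib_left mult.assoc del: index_mult_mat(1))
    finally show ?thesis .
  qed
  ultimately have "c * mtrace (H * G) / mtrace (H * G) \<in> \<rat>" by (metis Rats_divide)
  then show ?thesis using tr by simp
qed

section \<open>Synchronous correlations and the Frobenius inner product\<close>

text \<open>The Hilbert-Schmidt inner product, linear in the first argument to match
  \<open>\<bullet>c\<close> when vectors of length \<open>a * b\<close> are read as \<open>a\<close>
  by \<open>b\<close> matrices.\<close>

definition frob :: "nat \<Rightarrow> nat \<Rightarrow> complex mat \<Rightarrow> complex mat \<Rightarrow> complex" where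
  "frob a b X Y = (\<Sum>r<a. \<Sum>s<b. X $$ (r, s) * cnj (Y $$ (r, s)))"

definition hermitian_entries :: "nat \<Rightarrow> complex mat \<Rightarrow> bool" where
  "hermitian_entries n A \<longleftrightarrow> (\<forall>i<n. \<forall>j<n. A $$ (i, j) = cnj (A $$ (j, i)))"

lemma frob_mult_left:
  assumes A: "A \<in> carrier_mat a a" "hermitian_entries a A"
    and X: "X \<in> carrier_mat a b" and Y: "Y \<in> carrier_mat a b"
  shows "frob a b (A * X) Y = frob a b X (A * Y)"
proof -
  have "frob a b (A * X) Y = (\<Sum>r<a. \<Sum>s<b. \<Sum>t<a. A $$ (r, t) * X $$ (t, s) * cnj (Y $$ (r, s)))"
    unfolding frob_def
    by (intro sum.cong refl) (simp add: index_mult_mat_sum[OF A(1) X] sum_distrib_right del: index_mult_mat(1))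
  also have "\<dots> = (\<Sum>s<b. \<Sum>r<a. \<Sum>t<a. A $$ (r, t) * X $$ (t, s) * cnj (Y $$ (r, s)))"
    by (rule sum.swap)
  also have "\<dots> = (\<Sum>s<b. \<Sum>t<a. \<Sum>r<a. A $$ (r, t) * X $$ (t, s) * cnj (Y $$ (r, s)))"
    by (intro sum.cong refl sum.swap)
  also have "\<dots> = (\<Sum>t<a. \<Sum>s<b. \<Sum>r<a. A $$ (r, t) * X $$ (t, s) * cnj (Y $$ (r, s)))"
    by (rule sum.swap)
  also have "\<dots> = (\<Sum>t<a. \<Sum>s<b. \<Sum>r<a. X $$ (t, s) * cnj (A $$ (t, r) * Y $$ (r, s)))"
  proof (intro sum.cong refl)
    fix t s r assume "t \<in> {..<a}" "r \<in> {..<a}"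
    then have "A $$ (r, t) = cnj (A $$ (t, r))"
      using A(2) unfolding hermitian_entries_def by blast
    then show "A $$ (r, t) * X $$ (t, s) * cnj (Y $$ (r, s)) = X $$ (t, s) * cnj (A $$ (t, r) * Y $$ (r, s))"
      by simp
  qed
  also have "\<dots> = frob a b X (A * Y)"
    unfolding frob_def
    by (intro sum.cong refl) (simp add: index_mult_mat_sum[OF A(1) Y] sum_distrib_left del: index_mult_mat(1))
  finally show ?thesis .
qed

lemma frob_mult_right:
  assumes A: "A \<in> carrier_mat b b" "hermitian_entries b A"
    and X: "X \<in> carrier_mat a b" and Y: "Y \<in> carrier_mat a b"
  shows "frob a b (X * A) Y = frob a b X (Y * A)"
proof -
  have "frob a b (X * A) Y = (\<Sum>r<a. \<Sum>s<b. \<Sum>t<b. X $$ (r, t) * A $$ (t, s) * cnj (Y $$ (r, s)))"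
    unfolding frob_def
    by (intro sum.cong refl) (simp add: index_mult_mat_sum[OF X A(1)] sum_distrib_right del: index_mult_mat(1))
  also have "\<dots> = (\<Sum>r<a. \<Sum>t<b. \<Sum>s<b. X $$ (r, t) * A $$ (t, s) * cnj (Y $$ (r, s)))"
    by (intro sum.cong refl sum.swap)
  also have "\<dots> = (\<Sum>r<a. \<Sum>t<b. \<Sum>s<b. X $$ (r, t) * cnj (Y $$ (r, s) * A $$ (s, t)))"
  proof (intro sum.cong refl)
    fix r t s assume "t \<in> {..<b}" "s \<in> {..<b}"
    then have "A $$ (t, s) = cnj (A $$ (s, t))"
      using A(2) unfolding hermitian_entries_def by blast
    then show "X $$ (r, t) * A $$ (t, s) * cnj (Y $$ (r, s)) = X $$ (r, t) * cnj (Y $$ (r, s) * A $$ (s, t))"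
      by simp
  qed
  also have "\<dots> = frob a b X (Y * A)"
    unfolding frob_def
    by (intro sum.cong refl) (simp add: index_mult_mat_sum[OF Y A(1)] sum_distrib_left del: index_mult_mat(1))
  finally show ?thesis .
qed

lemma frob_commute: "frob a b Y X = cnj (frob a b X Y)"
  unfolding frob_def cnj_sum complex_cnj_mult complex_cnj_cnj by (simp only: mult.commute)

lemma frob_self: "frob a b X X = of_real (\<Sum>r<a. \<Sum>s<b. (cmod (X $$ (r, s)))\<^sup>2)"
  unfolding frob_def of_real_sum complex_norm_square ..

lemma frob_self_le_0_D:
  assumes "Re (frob a b X X) \<le> 0" "r < a" "s < b"
  shows "X $$ (r, s) = 0"
proof -
  have nonneg: "0 \<le> (\<Sum>s<b. (cmod (X $$ (r, s)))\<^sup>2)" for r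
    by (intro sum_nonneg) auto
  have "(\<Sum>r<a. \<Sum>s<b. (cmod (X $$ (r, s)))\<^sup>2) \<le> 0"
    using assms(1) by (simp add: frob_self)
  then have "(\<Sum>r<a. \<Sum>s<b. (cmod (X $$ (r, s)))\<^sup>2) = 0"
    using nonneg by (intro antisym sum_nonneg) auto
  then have "(\<Sum>s<b. (cmod (X $$ (r, s)))\<^sup>2) = 0"
    using assms(2) nonneg by (subst (asm) sum_nonneg_eq_0_iff) auto
  then show ?thesis
    using assms(3) by (subst (asm) sum_nonneg_eq_0_iff) auto
qed

lemma frob_self_zero:
  assumes "X \<in> carrier_mat a b" "frob a b X X = 0"
  shows "X = 0\<^sub>m a b"
proof (rule eq_matI)
  fix r s assume "r < dim_row (0\<^sub>m a b)" "s < dim_col (0\<^sub>m a b)"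
  then have rs: "r < a" "s < b" by auto
  have "Re (frob a b X X) \<le> 0" using assms(2) by simp
  from frob_self_le_0_D[OF this rs] show "X $$ (r, s) = 0\<^sub>m a b $$ (r, s)"
    using rs by simp
qed (use assms(1) in auto)

section \<open>Projections in coordinates, and tensor product vectors read as matrices\<close>

lemma mat_adjoint_index:
  assumes "A \<in> carrier_mat n m" "i < m" "j < n"
  shows "mat_adjoint A $$ (i, j) = conjugate (A $$ (j, i))"
  using assms by (simp add: mat_adjoint_def mat_of_rows_index)

lemma mat_adjoint_carrier:
  assumes "A \<in> carrier_mat n m"
  shows "mat_adjoint A \<in> carrier_mat m n"
  unfolding mat_adjoint_def using carrier_matD[OF assms]
  by (intro carrier_matI) simp_all

lemma orthogonal_projection_hermitian:
  assumes "orthogonal_projection d P"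
  shows "hermitian_entries d P"
  unfolding hermitian_entries_def
proof (intro allI impI)
  fix i j assume ij: "i < d" "j < d"
  have P: "P \<in> carrier_mat d d" and adj: "mat_adjoint P = P"
    using assms by (auto simp: orthogonal_projection_def)
  from mat_adjoint_index[OF P ij] show "P $$ (i, j) = cnj (P $$ (j, i))"
    by (simp add: adj)
qed

lemma orthogonal_projectionI:
  assumes "P \<in> carrier_mat d d" "hermitian_entries d P" "P * P = P"
  shows "orthogonal_projection d P"
proof -
  have "mat_adjoint P = P"
  proof (rule eq_matI)
    fix i j assume "i < dim_row P" "j < dim_col P"
    then have ij: "i < d" "j < d" using assms(1) by auto
    have "P $$ (i, j) = cnj (P $$ (j, i))"
      using assms(2) ij unfolding hermitian_entries_def by blast
    then show "mat_adjoint P $$ (i, j) = P $$ (i, j)"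
      unfolding mat_adjoint_index[OF assms(1) ij] conjugate_complex_def by (rule sym)
  qed (use assms(1) mat_adjoint_carrier[OF assms(1)] in auto)
  then show ?thesis using assms by (simp add: orthogonal_projection_def)
qed

lemma PVM_2_complement:
  fixes P :: "2 \<Rightarrow> complex mat"
  assumes "PVM d P"
  shows "P 2 = 1\<^sub>m d - P 1"
proof (rule eq_matI)
  have c: "P 1 \<in> carrier_mat d d" "P 2 \<in> carrier_mat d d"
    using assms by (auto simp: PVM_def orthogonal_projection_def)
  show "dim_row (P 2) = dim_row (1\<^sub>m d - P 1)" "dim_col (P 2) = dim_col (1\<^sub>m d - P 1)"
    using c by auto
  fix i j assume "i < dim_row (1\<^sub>m d - P 1)" "j < dim_col (1\<^sub>m d - P 1)"
  then have ij: "i < d" "j < d" using c by auto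
  have "mat d d (\<lambda>(r, s). \<Sum>i\<in>UNIV. P i $$ (r, s)) $$ (i, j) = 1\<^sub>m d $$ (i, j)"
    using assms by (simp add: PVM_def)
  then have "P 1 $$ (i, j) + P 2 $$ (i, j) = 1\<^sub>m d $$ (i, j)"
    using ij by (simp add: sum_2)
  then show "P 2 $$ (i, j) = (1\<^sub>m d - P 1) $$ (i, j)"
    using ij c by (simp add: algebra_simps)
qed

text \<open>Writing \<open>h\<close> row by row into the matrix \<open>H\<close> turns the action of
  A \<otimes> B into \<open>A * H * transpose_mat B\<close>. The index \<open>s + r * b\<close>
  agrees with the ordering in \<open>kronecker\<close>, so sums over \<open>a * b\<close> split into
  double sums.\<close>

lemma kronecker_expectation:
  assumes A: "A \<in> carrier_mat a a" and B: "B \<in> carrier_mat b b" and h: "h \<in> carrier_vec (a * b)"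
  defines "H \<equiv> mat a b (\<lambda>(r, s). h $ (s + r * b))"
  shows "(kronecker A B *\<^sub>v h) \<bullet>c h = frob a b (A * H * transpose_mat B) H"
proof -
  have lt: "s + r * b < a * b" if "r < a" "s < b" for r s
  proof -
    have "s + r * b < Suc r * b" using that by simp
    also have "\<dots> \<le> a * b" using that by (intro mult_right_mono) auto
    finally show ?thesis .
  qed
  have H: "H \<in> carrier_mat a b" by (simp add: H_def)
  have H_nth: "H $$ (r, s) = h $ (s + r * b)" if "r < a" "s < b" for r s
    using that by (simp add: H_def)
  have K: "kronecker A B \<in> carrier_mat (a * b) (a * b)"
    using A B by (simp add: kronecker_def)
  have K_nth: "kronecker A B $$ (s + r * b, s' + r' * b) = A $$ (r, r') * B $$ (s, s')"
    if "r < a" "s < b" "r' < a" "s' < b" for r s r' s'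
    using that A B lt by (simp add: kronecker_def)
  have Kh: "(kronecker A B *\<^sub>v h) $ (s + r * b) = (A * H * transpose_mat B) $$ (r, s)"
    if rs: "r < a" "s < b" for r s
  proof -
    have "(kronecker A B *\<^sub>v h) $ (s + r * b) = (\<Sum>t<a * b. kronecker A B $$ (s + r * b, t) * h $ t)"
      using K h lt[OF rs] by (simp add: scalar_prod_def atLeast0LessThan)
    also have "\<dots> = (\<Sum>r'<a. \<Sum>s'<b. A $$ (r, r') * B $$ (s, s') * H $$ (r', s'))"
      unfolding sum_mult_product using rs by (intro sum.cong refl) (simp add: K_nth H_nth)
    also have "\<dots> = (\<Sum>s'<b. (\<Sum>r'<a. A $$ (r, r') * H $$ (r', s')) * transpose_mat B $$ (s', s))"
      using rs B by (subst sum.swap) (simp add: sum_distrib_left mult_ac)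
    also have "\<dots> = (\<Sum>s'<b. (A * H) $$ (r, s') * transpose_mat B $$ (s', s))"
      using rs by (intro sum.cong refl) (simp add: index_mult_mat_sum[OF A H] del: index_mult_mat(1))
    also have "\<dots> = (A * H * transpose_mat B) $$ (r, s)"
      using A B H rs by (intro index_mult_mat_sum[symmetric, of _ a b _ b]) auto
    finally show ?thesis .
  qed
  have "(kronecker A B *\<^sub>v h) \<bullet>c h = (\<Sum>t<a * b. (kronecker A B *\<^sub>v h) $ t * cnj (h $ t))"
    using K h by (simp add: scalar_prod_def atLeast0LessThan del: index_mult_mat_vec)
  also have "\<dots> = frob a b (A * H * transpose_mat B) H"
    unfolding sum_mult_product frob_def
    by (intro sum.cong refl) (simp add: Kh H_nth del: index_mult_mat index_mult_mat_vec)
  finally show ?thesis .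
qed

lemma cscalar_prod_frob:
  assumes h: "h \<in> carrier_vec (a * b)"
  defines "H \<equiv> mat a b (\<lambda>(r, s). h $ (s + r * b))"
  shows "h \<bullet>c h = frob a b H H"
proof -
  have "h \<bullet>c h = (\<Sum>t<a * b. h $ t * cnj (h $ t))"
    using h by (simp add: scalar_prod_def atLeast0LessThan)
  also have "\<dots> = frob a b H H"
    unfolding sum_mult_product frob_def by (intro sum.cong refl) (simp add: H_def)
  finally show ?thesis .
qed

text \<open>Since \<open>E\<close> and \<open>N\<close> are self-adjoint idempotents, the inner
  product of \<open>E * H * N\<close> with \<open>H\<close> is already the squared norm of
  \<open>E * H * N\<close>.\<close>

lemma projection_sandwich_zero:
  assumes E: "E \<in> carrier_mat a a" "hermitian_entries a E" "E * E = E"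
    and N: "N \<in> carrier_mat b b" "hermitian_entries b N" "N * N = N"
    and H: "H \<in> carrier_mat a b" and 0: "frob a b (E * H * N) H = 0"
  shows "E * H * N = 0\<^sub>m a b"
proof -
  have EH: "E * H \<in> carrier_mat a b" and HN: "H * N \<in> carrier_mat a b"
    and X: "E * H * N \<in> carrier_mat a b" using E(1) N(1) H by auto
  have "frob a b (E * H * N) (E * H * N) = frob a b (E * H * N * N) (E * H)"
    by (rule frob_mult_right[OF N(1,2) X EH, symmetric])
  also have "E * H * N * N = E * H * N"
    using assoc_mult_mat[OF EH N(1) N(1)] N(3) by simp
  also have "frob a b (E * H * N) (E * H) = frob a b (E * (E * H * N)) H"
    by (rule frob_mult_left[OF E(1,2) X H, symmetric])
  also have "E * (E * H * N) = E * H * N"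
    using assoc_mult_mat[OF E(1) EH N(1)] assoc_mult_mat[OF E(1) E(1) H] E(3) by simp
  finally show ?thesis using frob_self_zero[OF X] 0 by simp
qed

lemma frob_sum_minus:
  fixes K :: "'n::finite \<Rightarrow> complex mat" and c :: complex
  assumes D: "\<And>r s. r < a \<Longrightarrow> s < b \<Longrightarrow> D $$ (r, s) = (\<Sum>v\<in>UNIV. K v $$ (r, s)) - c * H $$ (r, s)"
  shows "frob a b D D = (\<Sum>v\<in>UNIV. \<Sum>w\<in>UNIV. frob a b (K v) (K w))
     - cnj c * (\<Sum>v\<in>UNIV. frob a b (K v) H) - c * (\<Sum>v\<in>UNIV. frob a b H (K v)) + c * cnj c * frob a b H H"
proof -
  let ?k = "\<lambda>v r s. K v $$ (r, s)" and ?h = "\<lambda>r s. H $$ (r, s)"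
  have "frob a b D D = (\<Sum>r<a. \<Sum>s<b.
     (\<Sum>v\<in>UNIV. \<Sum>w\<in>UNIV. ?k v r s * cnj (?k w r s))
     - cnj c * (\<Sum>v\<in>UNIV. ?k v r s * cnj (?h r s))
     - c * (\<Sum>v\<in>UNIV. ?h r s * cnj (?k v r s))
     + c * cnj c * (?h r s * cnj (?h r s)))"
    unfolding frob_def
  proof (intro sum.cong refl)
    fix r s assume rs: "r \<in> {..<a}" "s \<in> {..<b}"
    define k where "k = (\<Sum>v\<in>UNIV. ?k v r s)"
    have k: "cnj k = (\<Sum>v\<in>UNIV. cnj (?k v r s))" by (simp add: k_def)
    have "(\<Sum>v\<in>UNIV. \<Sum>w\<in>UNIV. ?k v r s * cnj (?k w r s)) = k * cnj k"
      unfolding k unfolding k_def by (simp add: sum_product)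
    moreover have "(\<Sum>v\<in>UNIV. ?k v r s * cnj (?h r s)) = k * cnj (?h r s)"
      unfolding k_def by (simp add: sum_distrib_right)
    moreover have "(\<Sum>v\<in>UNIV. ?h r s * cnj (?k v r s)) = ?h r s * cnj k"
      unfolding k by (simp add: sum_distrib_left)
    moreover have "D $$ (r, s) = k - c * ?h r s"
      using rs by (simp add: D k_def)
    ultimately show "D $$ (r, s) * cnj (D $$ (r, s)) =
     (\<Sum>v\<in>UNIV. \<Sum>w\<in>UNIV. ?k v r s * cnj (?k w r s))
     - cnj c * (\<Sum>v\<in>UNIV. ?k v r s * cnj (?h r s))
     - c * (\<Sum>v\<in>UNIV. ?h r s * cnj (?k v r s))
     + c * cnj c * (?h r s * cnj (?h r s))"
      by (simp only:) (simp add: algebra_simps)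
  qed
  also have "\<dots> = (\<Sum>v\<in>UNIV. \<Sum>w\<in>UNIV. frob a b (K v) (K w))
     - cnj c * (\<Sum>v\<in>UNIV. frob a b (K v) H) - c * (\<Sum>v\<in>UNIV. frob a b H (K v)) + c * cnj c * frob a b H H"
  proof -
    have sw: "(\<Sum>r<a. \<Sum>s<b. \<Sum>v\<in>UNIV. F v r s) = (\<Sum>v\<in>UNIV. \<Sum>r<a. \<Sum>s<b. F v r s)" for F :: "'n \<Rightarrow> nat \<Rightarrow> nat \<Rightarrow> complex"
    proof -
      have "(\<Sum>r<a. \<Sum>s<b. \<Sum>v\<in>UNIV. F v r s) = (\<Sum>r<a. \<Sum>v\<in>UNIV. \<Sum>s<b. F v r s)"
        by (intro sum.cong refl sum.swap)
      also have "\<dots> = (\<Sum>v\<in>UNIV. \<Sum>r<a. \<Sum>s<b. F v r s)" by (rule sum.swap)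
      finally show ?thesis .
    qed
    show ?thesis
      unfolding frob_def sw[symmetric]
      by (simp add: sum.distrib sum_subtractf sum_distrib_left)
  qed
  finally show ?thesis .
qed

section \<open>From a synchronous correlation to a rational scalar\<close>

lemma complex_of_real_in_Rats_D:
  assumes "complex_of_real x \<in> \<rat>"
  shows "x \<in> \<rat>"
proof -
  obtain q where "complex_of_real x = of_rat q" using assms by (rule Rats_cases)
  also have "(of_rat q :: complex) = complex_of_real (of_rat q)"
    by (cases q) (simp add: of_rat_rat)
  finally have "x = of_rat q" by (rule of_real_eq_iff[THEN iffD1])
  then show ?thesis by simp
qed

lemma synchronous_quantum_correlation_rational:
  fixes p :: "real ^ (2 \<times> 2 \<times> 'n::finite \<times> 'n)" and lam :: real
  assumes p: "p \<in> synchronous_quantum_correlations"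
    and le: "(\<Sum>v\<in>UNIV. \<Sum>w\<in>UNIV. vec_nth p (1, 1, v, w)) - 2 * lam * (\<Sum>v\<in>UNIV. vec_nth p (1, 1, v, v)) + lam\<^sup>2 \<le> 0"
  shows "lam \<in> \<rat>"
proof -
  obtain a b and P Q :: "'n \<Rightarrow> 2 \<Rightarrow> complex mat" and h
    where P: "\<And>v. PVM a (P v)" and Q: "\<And>v. PVM b (Q v)"
      and h: "h \<in> carrier_vec (a * b)" and h1: "h \<bullet>c h = 1"
      and p_eq: "\<And>i j v w. complex_of_real (vec_nth p (i, j, v, w)) = (kronecker (P v i) (Q w j) *\<^sub>v h) \<bullet>c h"
    using p unfolding synchronous_quantum_correlations_def quantum_correlations_def by blast
  have sync: "vec_nth p (i, j, v, v) = 0" if "i \<noteq> j" for i j v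
    using p that by (simp add: synchronous_quantum_correlations_def synchronous_def)
  define H where "H = mat a b (\<lambda>(r, s). h $ (s + r * b))"
  have H: "H \<in> carrier_mat a b" by (simp add: H_def)
  have OP: "orthogonal_projection a (P v i)" for v i using P by (simp add: PVM_def)
  have OQ: "orthogonal_projection b (Q v i)" for v i using Q by (simp add: PVM_def)
  have Pc: "P v i \<in> carrier_mat a a" and PP: "P v i * P v i = P v i" and Ph: "hermitian_entries a (P v i)" for v i
    using OP[of v i] orthogonal_projection_hermitian[OF OP[of v i]] by (simp_all add: orthogonal_projection_def)
  \<comment> \<open>The second tensor factor acts on \<open>H\<close> by right multiplication with
    transposes. Transposition preserves idempotence and Hermitian symmetry, so these are projections
    as well.\<close>
  define R where "R v i = transpose_mat (Q v i)" for v i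
  have Qc: "Q v i \<in> carrier_mat b b" and QQ: "Q v i * Q v i = Q v i" and Qh: "hermitian_entries b (Q v i)" for v i
    using OQ[of v i] orthogonal_projection_hermitian[OF OQ[of v i]] by (simp_all add: orthogonal_projection_def)
  have Rc: "R v i \<in> carrier_mat b b" for v i using Qc by (simp add: R_def)
  have RR: "R v i * R v i = R v i" for v i
    using transpose_mult[OF Qc[of v i] Qc[of v i]] QQ[of v i] by (simp add: R_def)
  have Rh: "hermitian_entries b (R v i)" for v i
    unfolding hermitian_entries_def
  proof (intro allI impI)
    fix r s assume rs: "r < b" "s < b"
    then have "Q v i $$ (s, r) = cnj (Q v i $$ (r, s))"
      using Qh[of v i] unfolding hermitian_entries_def by blast
    then show "R v i $$ (r, s) = cnj (R v i $$ (s, r))"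
      using rs carrier_matD[OF Qc[of v i]] by (simp add: R_def)
  qed
  have p_frob: "complex_of_real (vec_nth p (i, j, v, w)) = frob a b (P v i * H * R w j) H" for i j v w
    unfolding p_eq H_def R_def by (rule kronecker_expectation[OF Pc Qc h])
  have P2: "P v 2 = 1\<^sub>m a - P v 1" for v by (rule PVM_2_complement[OF P])
  have R2: "R v 2 = 1\<^sub>m b - R v 1" for v
  proof -
    have "R v 2 = transpose_mat (1\<^sub>m b - Q v 1)"
      unfolding R_def by (simp add: PVM_2_complement[OF Q])
    also have "\<dots> = 1\<^sub>m b - R v 1"
      unfolding R_def using Qc[of v 1] by (intro eq_matI) auto
    finally show ?thesis .
  qed
  \<comment> \<open>The coordinate \<open>p(i, j | v, v)\<close> is the squared norm of this
    product, so synchronicity annihilates it.\<close>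
  have zero: "P v i * H * R v j = 0\<^sub>m a b" if "i \<noteq> j" for v i j
    by (rule projection_sandwich_zero[OF Pc Ph PP Rc Rh RR H])
       (use p_frob[of i j v v] sync[OF that] in simp)
  have PHc: "P v 1 * H \<in> carrier_mat a b" and HRc: "H * R v 1 \<in> carrier_mat a b" for v
    using Pc[of v 1] Rc[of v 1] H by auto
  have PHRc: "P v 1 * H * R v 1 \<in> carrier_mat a b" for v
    using PHc[of v] Rc[of v 1] by auto
  \<comment> \<open>With two outcomes, the unequal pairs read \<open>P H (1 - R) = 0\<close> and
    \<open>(1 - P) H R = 0\<close>. Both \<open>P H\<close> and \<open>H R\<close> therefore
    coincide with \<open>P H R\<close>.\<close>
  have "P v 1 * H - P v 1 * H * R v 1 = 0\<^sub>m a b" for v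
    using zero[of 1 2 v] mult_minus_distrib_mat[OF PHc[of v] one_carrier_mat Rc[of v 1]]
      right_mult_one_mat[OF PHc[of v]] by (simp add: R2)
  moreover have "H * R v 1 - P v 1 * H * R v 1 = 0\<^sub>m a b" for v
    using zero[of 2 1 v] minus_mult_distrib_mat[OF one_carrier_mat Pc[of v 1] H]
      minus_mult_distrib_mat[OF H PHc[of v] Rc[of v 1]]
      left_mult_one_mat[OF H] by (simp add: P2)
  ultimately have PH: "P v 1 * H = P v 1 * H * R v 1" and HR: "H * R v 1 = P v 1 * H * R v 1" for v
  proof -
    have eqI: "X = Y" if "X - Y = 0\<^sub>m a b" "X \<in> carrier_mat a b" "Y \<in> carrier_mat a b" for X Y :: "complex mat"
    proof (rule eq_matI)
      fix r s assume "r < dim_row Y" "s < dim_col Y"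
      then have rs: "r < a" "s < b" using that by auto
      then have "(X - Y) $$ (r, s) = 0" using that(1) by simp
      then show "X $$ (r, s) = Y $$ (r, s)" using rs that(2,3) by simp
    qed (use that in auto)
    fix v
    assume 1: "\<And>v. P v 1 * H - P v 1 * H * R v 1 = 0\<^sub>m a b" and 2: "\<And>v. H * R v 1 - P v 1 * H * R v 1 = 0\<^sub>m a b"
    show "P v 1 * H = P v 1 * H * R v 1" by (rule eqI[OF 1 PHc PHRc])
    show "H * R v 1 = P v 1 * H * R v 1" by (rule eqI[OF 2 HRc PHRc])
  qed
  have PH_HR: "P v 1 * H = H * R v 1" for v
    unfolding HR by (rule PH)
  define K where "K v = P v 1 * H" for v
  have Kc: "K v \<in> carrier_mat a b" for v using PHc by (simp add: K_def)
  \<comment> \<open>Replacing \<open>P w 1 * H\<close> by \<open>H * R w 1\<close> and moving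
    \<open>R w 1\<close> to the first argument produces the sandwich that computes
    \<open>p(1, 1 | v, w)\<close>.\<close>
  have KK: "frob a b (K v) (K w) = of_real (vec_nth p (1, 1, v, w))" for v w
  proof -
    have "frob a b (K v) (K w) = frob a b (K v) (H * R w 1)"
      by (simp add: K_def PH_HR)
    also have "\<dots> = frob a b (K v * R w 1) H"
      by (rule frob_mult_right[OF Rc Rh Kc H, symmetric])
    finally show ?thesis by (simp add: p_frob K_def)
  qed
  have KH: "frob a b (K v) H = of_real (vec_nth p (1, 1, v, v))" for v
    using p_frob[of 1 1 v v] PH[of v] by (simp add: K_def)
  have HK: "frob a b H (K v) = of_real (vec_nth p (1, 1, v, v))" for v
    using frob_commute[of a b H "K v"] by (simp add: KH)
  have HH: "frob a b H H = 1"
    using cscalar_prod_frob[OF h] h1 by (simp add: H_def)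
  \<comment> \<open>The squared norm of \<open>D\<close> is exactly the expression bounded in
    \<open>le\<close>; it can only vanish, which makes the \<open>P v 1\<close> sum to
    \<open>lam\<close> on the range of \<open>H\<close>.\<close>
  define D where "D = mat a b (\<lambda>(r, s). (\<Sum>v\<in>UNIV. K v $$ (r, s)) - of_real lam * H $$ (r, s))"
  have "frob a b D D = (\<Sum>v\<in>UNIV. \<Sum>w\<in>UNIV. frob a b (K v) (K w))
     - cnj (of_real lam) * (\<Sum>v\<in>UNIV. frob a b (K v) H) - of_real lam * (\<Sum>v\<in>UNIV. frob a b H (K v))
     + of_real lam * cnj (of_real lam) * frob a b H H"
    by (rule frob_sum_minus) (simp add: D_def)
  also have "\<dots> = of_real ((\<Sum>v\<in>UNIV. \<Sum>w\<in>UNIV. vec_nth p (1, 1, v, w)) - 2 * lam * (\<Sum>v\<in>UNIV. vec_nth p (1, 1, v, v)) + lam\<^sup>2)"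
    by (simp add: KK KH HK HH power2_eq_square)
  finally have "Re (frob a b D D) \<le> 0"
    using le by simp
  from frob_self_le_0_D[OF this] have sum: "(\<Sum>v\<in>UNIV. K v $$ (r, s)) = of_real lam * H $$ (r, s)" if "r < a" "s < b" for r s
    using that by (simp add: D_def)
  have "H \<noteq> 0\<^sub>m a b" using HH by (auto simp: frob_def)
  then have "complex_of_real lam \<in> \<rat>"
    using intertwined_idempotents_rational[OF H _ Pc PP Rc PH_HR sum[unfolded K_def]] by blast
  then show ?thesis by (rule complex_of_real_in_Rats_D)
qed

section \<open>Correlations from the normalized trace\<close>

text \<open>The matrices constructed below are real, so symmetric idempotents are kept as functions
  of two indices; carriers and conjugation enter only through \<open>complexify\<close>.\<close>

definition real_projection :: "nat \<Rightarrow> (nat \<Rightarrow> nat \<Rightarrow> real) \<Rightarrow> bool" where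
  "real_projection d A \<longleftrightarrow>
     (\<forall>r<d. \<forall>s<d. A r s = A s r \<and> (\<Sum>t<d. A r t * A t s) = A r s)"

lemma real_projection_symmetric: "real_projection d A \<Longrightarrow> r < d \<Longrightarrow> s < d \<Longrightarrow> A r s = A s r"
  unfolding real_projection_def by blast

lemma real_projection_idempotent: "real_projection d A \<Longrightarrow> r < d \<Longrightarrow> s < d \<Longrightarrow> (\<Sum>t<d. A r t * A t s) = A r s"
  unfolding real_projection_def by blast

lemma real_projection_row_square:
  assumes "real_projection d A" "r < d"
  shows "(\<Sum>t<d. A r t * A r t) = A r r"
proof -
  have "(\<Sum>t<d. A r t * A r t) = (\<Sum>t<d. A r t * A t r)"
    using assms by (intro sum.cong refl arg_cong[where f = "\<lambda>x. _ * x"] real_projection_symmetric) auto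
  then show ?thesis using real_projection_idempotent[OF assms(1,2,2)] by simp
qed

text \<open>The square of the diagonal entry is one term of the sum of squares of its row, and that
  sum is the diagonal entry itself.\<close>

lemma real_projection_diagonal_le_1:
  assumes "real_projection d A" "r < d"
  shows "A r r \<le> 1"
proof -
  note sq = real_projection_row_square[OF assms]
  have "A r r * A r r \<le> (\<Sum>t<d. A r t * A r t)"
    using assms(2) by (intro member_le_sum[of r "{..<d}" "\<lambda>t. A r t * A r t"]) auto
  then have "A r r * A r r \<le> A r r" by (simp add: sq)
  then show ?thesis
    using mult_strict_left_mono[of 1 "A r r" "A r r"] by linarith
qed

lemma real_projection_complement:
  assumes A: "real_projection d A"
  shows "real_projection d (\<lambda>r s. of_bool (r = s) - A r s)"
  unfolding real_projection_def
proof (intro allI impI conjI)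
  fix r s assume rs: "r < d" "s < d"
  show "of_bool (r = s) - A r s = of_bool (s = r) - A s r"
    using real_projection_symmetric[OF A rs] by auto
  have "(\<Sum>t<d. (of_bool (r = t) - A r t) * (of_bool (t = s) - A t s)) =
    (\<Sum>t<d. (if t = r then of_bool (t = s) - A t s else 0) - (if t = s then A r t else 0) + A r t * A t s)"
    by (intro sum.cong) (auto simp: algebra_simps)
  also have "\<dots> = of_bool (r = s) - A r s"
    using rs real_projection_idempotent[OF A rs] by (simp add: sum.distrib sum_subtractf)
  finally show "(\<Sum>t<d. (of_bool (r = t) - A r t) * (of_bool (t = s) - A t s)) = of_bool (r = s) - A r s" .
qed

definition complexify :: "nat \<Rightarrow> (nat \<Rightarrow> nat \<Rightarrow> real) \<Rightarrow> complex mat" where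
  "complexify d A = mat d d (\<lambda>(r, s). of_real (A r s))"

lemma complexify_projection:
  assumes A: "real_projection d A"
  shows "orthogonal_projection d (complexify d A)"
proof (rule orthogonal_projectionI)
  show c: "complexify d A \<in> carrier_mat d d" by (simp add: complexify_def)
  show "hermitian_entries d (complexify d A)"
    unfolding hermitian_entries_def
  proof (intro allI impI)
    fix r s assume rs: "r < d" "s < d"
    have "complexify d A $$ (r, s) = of_real (A r s)" "complexify d A $$ (s, r) = of_real (A s r)"
      using rs by (simp_all add: complexify_def)
    then show "complexify d A $$ (r, s) = cnj (complexify d A $$ (s, r))"
      unfolding real_projection_symmetric[OF A rs] by simp
  qed
  show "complexify d A * complexify d A = complexify d A"
  proof (rule eq_matI)
    fix r s assume "r < dim_row (complexify d A)" "s < dim_col (complexify d A)"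
    then have rs: "r < d" "s < d" by (auto simp: complexify_def)
    have "(complexify d A * complexify d A) $$ (r, s) = of_real (\<Sum>t<d. A r t * A t s)"
      unfolding index_mult_mat_sum[OF c c rs] using rs by (simp add: complexify_def)
    then show "(complexify d A * complexify d A) $$ (r, s) = complexify d A $$ (r, s)"
      unfolding real_projection_idempotent[OF A rs] using rs by (simp add: complexify_def)
  qed (simp_all add: complexify_def)
qed

definition outcome :: "(nat \<Rightarrow> nat \<Rightarrow> real) \<Rightarrow> 2 \<Rightarrow> nat \<Rightarrow> nat \<Rightarrow> real" where
  "outcome A i r s = (if i = 1 then A r s else of_bool (r = s) - A r s)"

lemma outcome_projection: "real_projection d A \<Longrightarrow> real_projection d (outcome A i)"
  using real_projection_complement[of d A] by (cases "i = 1") (auto simp: outcome_def[abs_def])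

lemma outcome_PVM:
  assumes "real_projection d A"
  shows "PVM d (\<lambda>i. complexify d (outcome A i))"
proof -
  have "mat d d (\<lambda>(r, s). \<Sum>i\<in>UNIV. complexify d (outcome A i) $$ (r, s)) = 1\<^sub>m d"
    by (rule eq_matI) (auto simp: sum_2 complexify_def outcome_def)
  then show ?thesis
    using complexify_projection[OF outcome_projection[OF assms]] by (simp add: PVM_def)
qed

text \<open>By symmetry of the projections, the double sum of entrywise products is the trace of the
  matrix product.\<close>

definition tracial_correlation ::
    "nat \<Rightarrow> ('n::finite \<Rightarrow> nat \<Rightarrow> nat \<Rightarrow> real) \<Rightarrow> real ^ (2 \<times> 2 \<times> 'n \<times> 'n)" where
  "tracial_correlation d A = vec_lambda (\<lambda>(i, j, v, w).
     (\<Sum>r<d. \<Sum>s<d. outcome (A v) i r s * outcome (A w) j r s) / d)"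

lemma tracial_correlation_nth:
  "vec_nth (tracial_correlation d A) (i, j, v, w) =
     (\<Sum>r<d. \<Sum>s<d. outcome (A v) i r s * outcome (A w) j r s) / d"
  by (simp add: tracial_correlation_def)

text \<open>Unequal outcomes are a projection and its complement in some order; each row contributes
  \<open>A v r r\<close> minus the sum of its squares, which is 0.\<close>

lemma tracial_correlation_synchronous:
  assumes A: "\<And>v. real_projection d (A v)"
  shows "synchronous (tracial_correlation d A)"
proof -
  have "outcome (A v) i r s * outcome (A v) j r s = of_bool (r = s) * A v r s - A v r s * A v r s"
    if "i \<noteq> j" for v i j r s
    using exhaust_2[of i] exhaust_2[of j] that by (auto simp: outcome_def algebra_simps)
  moreover have "(\<Sum>r<d. \<Sum>s<d. of_bool (r = s) * A v r s - A v r s * A v r s) = 0" for v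
  proof (rule sum.neutral, rule ballI)
    fix r assume "r \<in> {..<d}"
    then have r: "r < d" by simp
    have "(\<Sum>s<d. of_bool (r = s) * A v r s) = (\<Sum>s<d. if s = r then A v r r else 0)"
      by (intro sum.cong) auto
    then show "(\<Sum>s<d. of_bool (r = s) * A v r s - A v r s * A v r s) = 0"
      unfolding sum_subtractf real_projection_row_square[OF A r] using r by simp
  qed
  ultimately show ?thesis
    unfolding synchronous_def tracial_correlation_nth by simp
qed

lemma tracial_correlation_quantum:
  assumes A: "\<And>v. real_projection d (A v)" and d: "d > 0"
  shows "tracial_correlation d A \<in> synchronous_quantum_correlations"
proof -
  define P where "P v i = complexify d (outcome (A v) i)" for v i
  have Pc: "P v i \<in> carrier_mat d d" for v i by (simp add: P_def complexify_def)
  have P_nth: "P v i $$ (r, s) = of_real (outcome (A v) i r s)" if "r < d" "s < d" for v i r s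
    using that by (simp add: P_def complexify_def)
  have PVM: "PVM d (P v)" for v unfolding P_def by (rule outcome_PVM[OF A])
  \<comment> \<open>The maximally entangled vector: the indices with
    \<open>t div d = t mod d\<close> are the diagonal positions, so the matrix of \<open>h\<close>
    is the identity divided by \<open>sqrt d\<close>.\<close>
  define h :: "complex vec" where "h = vec (d * d) (\<lambda>t. if t div d = t mod d then of_real (1 / sqrt d) else 0)"
  have h: "h \<in> carrier_vec (d * d)" by (simp add: h_def)
  define H where "H = mat d d (\<lambda>(r, s). h $ (s + r * d))"
  have H: "H \<in> carrier_mat d d" by (simp add: H_def)
  have H_nth: "H $$ (r, s) = (if r = s then of_real (1 / sqrt d) else 0)" if "r < d" "s < d" for r s
  proof -
    have "s + r * d < Suc r * d" using that by simp
    also have "\<dots> \<le> d * d" using that by (intro mult_right_mono) auto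
    finally have "s + r * d < d * d" .
    moreover have "(s + r * d) div d = r" "(s + r * d) mod d = s" using that by auto
    ultimately show ?thesis using that by (simp add: H_def h_def)
  qed
  have sq: "complex_of_real (1 / sqrt d) * complex_of_real (1 / sqrt d) = of_real (1 / d)"
    unfolding of_real_mult[symmetric] by (simp add: real_sqrt_mult_self)
  have frob_H: "frob d d X H = (\<Sum>r<d. X $$ (r, r) * of_real (1 / sqrt d))" for X
  proof -
    have "frob d d X H = (\<Sum>r<d. \<Sum>s<d. if s = r then X $$ (r, r) * of_real (1 / sqrt d) else 0)"
      unfolding frob_def by (intro sum.cong refl) (auto simp: H_nth)
    then show ?thesis by simp
  qed
  have norm: "h \<bullet>c h = 1"
  proof -
    have "h \<bullet>c h = frob d d H H" unfolding H_def by (rule cscalar_prod_frob[OF h])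
    also have "\<dots> = (\<Sum>r<d. of_real (1 / d))"
      unfolding frob_H by (intro sum.cong refl) (simp only: H_nth simp_thms if_True sq lessThan_iff)
    also have "\<dots> = 1" using d by simp
    finally show ?thesis .
  qed
  have "complex_of_real (vec_nth (tracial_correlation d A) (i, j, v, w)) =
     (kronecker (P v i) (P w j) *\<^sub>v h) \<bullet>c h" for i j v w
  proof -
    have PH: "(P v i * H) $$ (r, s) = P v i $$ (r, s) * of_real (1 / sqrt d)" if "r < d" "s < d" for r s
    proof -
      have "(P v i * H) $$ (r, s) = (\<Sum>t<d. if t = s then P v i $$ (r, s) * of_real (1 / sqrt d) else 0)"
        unfolding index_mult_mat_sum[OF Pc H that] using that by (intro sum.cong refl) (simp add: H_nth)
      then show ?thesis using that by simp
    qed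
    have PHc: "P v i * H \<in> carrier_mat d d" using Pc[of v i] H by auto
    have PTc: "transpose_mat (P w j) \<in> carrier_mat d d" using Pc[of w j] by auto
    have "(kronecker (P v i) (P w j) *\<^sub>v h) \<bullet>c h = frob d d (P v i * H * transpose_mat (P w j)) H"
      unfolding H_def by (rule kronecker_expectation[OF Pc Pc h])
    also have "\<dots> = (\<Sum>r<d. \<Sum>s<d. P v i $$ (r, s) * P w j $$ (r, s) * of_real (1 / d))"
      unfolding frob_H
    proof (intro sum.cong refl)
      fix r assume "r \<in> {..<d}"
      then have r: "r < d" by simp
      have "(P v i * H * transpose_mat (P w j)) $$ (r, r) =
         (\<Sum>s<d. P v i $$ (r, s) * of_real (1 / sqrt d) * P w j $$ (r, s))"
        unfolding index_mult_mat_sum[OF PHc PTc r r]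
      proof (intro sum.cong refl)
        fix s assume "s \<in> {..<d}"
        then have s: "s < d" by simp
        show "(P v i * H) $$ (r, s) * transpose_mat (P w j) $$ (s, r) = P v i $$ (r, s) * of_real (1 / sqrt d) * P w j $$ (r, s)"
          unfolding PH[OF r s] using r s carrier_matD[OF Pc[of w j]] by simp
      qed
      then have "(P v i * H * transpose_mat (P w j)) $$ (r, r) * of_real (1 / sqrt d) =
         (\<Sum>s<d. P v i $$ (r, s) * P w j $$ (r, s) * (of_real (1 / sqrt d) * of_real (1 / sqrt d)))"
        by (simp only: sum_distrib_left mult_ac)
      then show "(P v i * H * transpose_mat (P w j)) $$ (r, r) * of_real (1 / sqrt d) =
         (\<Sum>s<d. P v i $$ (r, s) * P w j $$ (r, s) * of_real (1 / d))"
        unfolding sq .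
    qed
    also have "\<dots> = complex_of_real (vec_nth (tracial_correlation d A) (i, j, v, w))"
      by (simp add: tracial_correlation_nth P_nth sum_divide_distrib)
    finally show ?thesis by simp
  qed
  then have "tracial_correlation d A \<in> quantum_correlations"
    unfolding quantum_correlations_def using PVM h norm by blast
  then show ?thesis
    using tracial_correlation_synchronous[of d A, OF A] by (simp add: synchronous_quantum_correlations_def)
qed

text \<open>Bounding each product by half the sum of squares reduces a row to the mean of two
  diagonal entries, both at most 1. The bound confines these correlations to a compact cube.\<close>

lemma tracial_correlation_bound:
  assumes A: "\<And>v. real_projection d (A v)"
  shows "\<bar>vec_nth (tracial_correlation d A) k\<bar> \<le> 1"
proof -
  obtain i j v w where k: "k = (i, j, v, w)" by (cases k) auto
  let ?X = "outcome (A v) i" and ?Y = "outcome (A w) j"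
  have X: "real_projection d ?X" and Y: "real_projection d ?Y" by (intro outcome_projection A)+
  have "\<bar>\<Sum>r<d. \<Sum>s<d. ?X r s * ?Y r s\<bar> \<le> (\<Sum>r<d. \<bar>\<Sum>s<d. ?X r s * ?Y r s\<bar>)"
    by (rule sum_abs)
  also have "\<dots> \<le> (\<Sum>r<d. 1)"
  proof (intro sum_mono)
    fix r assume "r \<in> {..<d}"
    then have r: "r < d" by simp
    have "\<bar>\<Sum>s<d. ?X r s * ?Y r s\<bar> \<le> (\<Sum>s<d. \<bar>?X r s * ?Y r s\<bar>)"
      by (rule sum_abs)
    also have "\<dots> \<le> (\<Sum>s<d. (?X r s * ?X r s + ?Y r s * ?Y r s) / 2)"
    proof (intro sum_mono)
      fix s
      have "0 \<le> (\<bar>?X r s\<bar> - \<bar>?Y r s\<bar>)\<^sup>2" by simp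
      then show "\<bar>?X r s * ?Y r s\<bar> \<le> (?X r s * ?X r s + ?Y r s * ?Y r s) / 2"
        by (simp add: power2_eq_square algebra_simps abs_mult)
    qed
    also have "\<dots> = (?X r r + ?Y r r) / 2"
      unfolding sum_divide_distrib[symmetric] sum.distrib
        real_projection_row_square[OF X r] real_projection_row_square[OF Y r] ..
    also have "\<dots> \<le> 1"
      using real_projection_diagonal_le_1[OF X r] real_projection_diagonal_le_1[OF Y r] by simp
    finally show "\<bar>\<Sum>s<d. ?X r s * ?Y r s\<bar> \<le> 1" .
  qed
  finally have "\<bar>\<Sum>r<d. \<Sum>s<d. ?X r s * ?Y r s\<bar> \<le> d" by simp
  then show ?thesis
    unfolding k tracial_correlation_nth by (cases "d = 0") (simp_all add: abs_divide)
qed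

text \<open>Expansion of the normalized squared norm of the sum of the projections minus
  \<open>lam\<close> times the identity; the mixed term is linear in the coordinates because the
  entries of a projection have squares summing to its trace.\<close>

lemma tracial_correlation_defect:
  assumes A: "\<And>v. real_projection d (A v)" and d: "d > 0"
  shows "(\<Sum>v\<in>UNIV. \<Sum>w\<in>UNIV. vec_nth (tracial_correlation d A) (1, 1, v, w))
      - 2 * lam * (\<Sum>v\<in>UNIV. vec_nth (tracial_correlation d A) (1, 1, v, v)) + lam\<^sup>2
    = (\<Sum>r<d. \<Sum>s<d. ((\<Sum>v\<in>UNIV. A v r s) - lam * of_bool (r = s))\<^sup>2) / d"
proof -
  define S where "S r s = (\<Sum>v\<in>UNIV. A v r s)" for r s
  have swap: "(\<Sum>v\<in>UNIV. \<Sum>r<d. \<Sum>s<d. F v r s) = (\<Sum>r<d. \<Sum>s<d. \<Sum>v\<in>UNIV. F v r s)" for F :: "'a \<Rightarrow> nat \<Rightarrow> nat \<Rightarrow> real"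
  proof -
    have "(\<Sum>v\<in>UNIV. \<Sum>r<d. \<Sum>s<d. F v r s) = (\<Sum>r<d. \<Sum>v\<in>UNIV. \<Sum>s<d. F v r s)"
      by (rule sum.swap)
    also have "\<dots> = (\<Sum>r<d. \<Sum>s<d. \<Sum>v\<in>UNIV. F v r s)"
      by (intro sum.cong refl sum.swap)
    finally show ?thesis .
  qed
  have "(\<Sum>v\<in>UNIV. \<Sum>w\<in>UNIV. \<Sum>r<d. \<Sum>s<d. A v r s * A w r s) = (\<Sum>r<d. \<Sum>s<d. S r s * S r s)"
    unfolding S_def sum_product by (simp only: swap)
  moreover have "(\<Sum>v\<in>UNIV. \<Sum>r<d. \<Sum>s<d. A v r s * A v r s) = (\<Sum>r<d. S r r)"
  proof -
    have "(\<Sum>v\<in>UNIV. \<Sum>r<d. \<Sum>s<d. A v r s * A v r s) = (\<Sum>v\<in>UNIV. \<Sum>r<d. A v r r)"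
      by (intro sum.cong refl real_projection_row_square A) auto
    also have "\<dots> = (\<Sum>r<d. S r r)"
      unfolding S_def by (rule sum.swap)
    finally show ?thesis .
  qed
  moreover have "(\<Sum>r<d. \<Sum>s<d. (S r s - lam * of_bool (r = s))\<^sup>2) =
      (\<Sum>r<d. \<Sum>s<d. S r s * S r s) - 2 * lam * (\<Sum>r<d. S r r) + lam\<^sup>2 * d"
  proof -
    have "(\<Sum>s<d. (S r s - lam * of_bool (r = s))\<^sup>2) = (\<Sum>s<d. S r s * S r s) - 2 * lam * S r r + lam\<^sup>2"
      if "r < d" for r
    proof -
      have "(\<Sum>s<d. (S r s - lam * of_bool (r = s))\<^sup>2)
          = (\<Sum>s<d. S r s * S r s + (if s = r then lam\<^sup>2 - 2 * lam * S r r else 0))"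
        by (intro sum.cong refl) (auto simp: power2_eq_square algebra_simps)
      then show ?thesis using that by (simp add: sum.distrib)
    qed
    then show ?thesis
      by (simp add: sum.distrib sum_subtractf sum_distrib_left)
  qed
  ultimately show ?thesis
    unfolding tracial_correlation_nth outcome_def sum_divide_distrib[symmetric]
    using d by (simp add: S_def[symmetric] field_simps)
qed

section \<open>Five projections with almost scalar sum\<close>

text \<open>
  For an involution \<open>\<sigma>\<close> this is the direct sum of the rank one blocks with rows \<open>(c, e \<surd>(c (1 - c)))\<close>
  and \<open>(e \<surd>(c (1 - c)), 1 - c)\<close>, \<open>e = \<plusminus>1\<close>, on the orbits \<open>{r, \<sigma> r}\<close>. The off-diagonal entries
  cancel when the projections for \<open>e = 1\<close> and \<open>e = -1\<close> are added.
\<close>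

definition matching_projection :: "(nat \<Rightarrow> nat) \<Rightarrow> (nat \<Rightarrow> real) \<Rightarrow> real \<Rightarrow> nat \<Rightarrow> nat \<Rightarrow> real" where
  "matching_projection \<sigma> c e r s = of_bool (s = r) * c r + of_bool (s = \<sigma> r) * (e * sqrt (c r * (1 - c r)))"

text \<open>On an orbit of two indices the block has trace 1 and determinant 0, hence is idempotent.
  At a fixed point both indicators hit the same entry, and \<open>c r \<in> {0, 1}\<close> makes the
  square root vanish.\<close>

lemma matching_projection:
  assumes range: "\<And>r. r < d \<Longrightarrow> \<sigma> r < d" and inv: "\<And>r. r < d \<Longrightarrow> \<sigma> (\<sigma> r) = r"
    and c: "\<And>r. r < d \<Longrightarrow> 0 \<le> c r" "\<And>r. r < d \<Longrightarrow> c r \<le> 1"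
    and pair: "\<And>r. r < d \<Longrightarrow> \<sigma> r \<noteq> r \<Longrightarrow> c (\<sigma> r) = 1 - c r"
    and fixed: "\<And>r. r < d \<Longrightarrow> \<sigma> r = r \<Longrightarrow> c r \<in> {0, 1}"
    and e: "e * e = 1"
  shows "real_projection d (matching_projection \<sigma> c e)"
proof -
  define g where "g r = e * sqrt (c r * (1 - c r))" for r
  let ?A = "matching_projection \<sigma> c e"
  have A: "?A r s = of_bool (s = r) * c r + of_bool (s = \<sigma> r) * g r" for r s
    by (simp add: matching_projection_def g_def)
  have g_fixed: "g r = 0" if "r < d" "\<sigma> r = r" for r
    using fixed[OF that] by (auto simp: g_def)
  have g_pair: "g (\<sigma> r) = g r" if "r < d" for r
  proof (cases "\<sigma> r = r")
    case False
    then show ?thesis using pair[OF that False] by (simp add: g_def mult.commute)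
  qed simp
  have g_sq: "g r * g r = c r * (1 - c r)" if "r < d" for r
  proof -
    have "g r * g r = (e * e) * (sqrt (c r * (1 - c r)) * sqrt (c r * (1 - c r)))"
      by (simp add: g_def mult_ac)
    then show ?thesis using c[OF that] by (simp add: e)
  qed
  show ?thesis
    unfolding real_projection_def
  proof (intro allI impI conjI)
    fix r s assume rs: "r < d" "s < d"
    have "s = \<sigma> r \<longleftrightarrow> r = \<sigma> s" using inv rs by metis
    then show "?A r s = ?A s r"
      using g_pair[OF rs(1)] g_pair[OF rs(2)] by (auto simp: A)
    have "(\<Sum>t<d. ?A r t * ?A t s) =
      (\<Sum>t<d. (if t = r then c r * ?A r s else 0) + (if t = \<sigma> r then g r * ?A (\<sigma> r) s else 0))"
      by (intro sum.cong refl) (simp add: A[of r] algebra_simps)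
    also have "\<dots> = c r * ?A r s + g r * ?A (\<sigma> r) s"
      using rs range[OF rs(1)] by (simp add: sum.distrib)
    also have "\<dots> = ?A r s"
    proof (cases "\<sigma> r = r")
      case True
      then show ?thesis using g_fixed[OF rs(1) True] fixed[OF rs(1) True] by (auto simp: A)
    next
      case False
      then have ne: "\<sigma> r \<noteq> r" by simp
      have "?A (\<sigma> r) s = of_bool (s = \<sigma> r) * (1 - c r) + of_bool (s = r) * g r"
        unfolding A pair[OF rs(1) ne] g_pair[OF rs(1)] inv[OF rs(1)] ..
      then have "c r * ?A r s + g r * ?A (\<sigma> r) s =
        of_bool (s = r) * (c r * c r + g r * g r) + of_bool (s = \<sigma> r) * g r"
        unfolding A[of r] by (simp only:) (simp add: algebra_simps)
      also have "\<dots> = ?A r s"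
        unfolding g_sq[OF rs(1)] by (simp add: A algebra_simps)
      finally show ?thesis .
    qed
    finally show "(\<Sum>t<d. ?A r t * ?A t s) = ?A r s" .
  qed
qed

text \<open>
  On an interior row the blocks of the even and odd matchings contribute \<open>frac (r \<theta>)\<close> and
  \<open>2 - frac ((r - 1) \<theta>)\<close> in total; the fifth projection, diagonal with entries \<open>jump\<close>, makes up for
  the jumps of the fractional part, so that the diagonal of the sum is constantly \<open>2 + \<theta>\<close> there.
\<close>

definition even_match :: "nat \<Rightarrow> nat" where
  "even_match r = (if even r then r + 1 else r - 1)"

definition odd_match :: "nat \<Rightarrow> nat \<Rightarrow> nat" where
  "odd_match d r = (if r = 0 \<or> r = d - 1 then r else if odd r then r + 1 else r - 1)"

text \<open>The upper index of a pair carries the complement of the weight of the lower one, whose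
  index is \<open>r - 1\<close>. The halves compensate for every weight occurring twice, with
  \<open>e = 1\<close> and \<open>e = - 1\<close>.\<close>

definition even_weight :: "real \<Rightarrow> nat \<Rightarrow> real" where
  "even_weight \<theta> r = (if even r then frac (r * \<theta>) / 2 else 1 - frac (real (r - 1) * \<theta>) / 2)"

definition odd_weight :: "real \<Rightarrow> nat \<Rightarrow> nat \<Rightarrow> real" where
  "odd_weight \<theta> d r = (if r = 0 \<or> r = d - 1 then 0
     else if odd r then frac (r * \<theta>) / 2 else 1 - frac (real (r - 1) * \<theta>) / 2)"

definition jump :: "real \<Rightarrow> nat \<Rightarrow> real" where
  "jump \<theta> r = of_int (\<lfloor>r * \<theta>\<rfloor> - \<lfloor>r * \<theta> - \<theta>\<rfloor>)"

definition five_projections :: "real \<Rightarrow> nat \<Rightarrow> 5 \<Rightarrow> nat \<Rightarrow> nat \<Rightarrow> real" where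
  "five_projections \<theta> d v =
     (if v = 1 then matching_projection even_match (even_weight \<theta>) 1
      else if v = 2 then matching_projection even_match (even_weight \<theta>) (- 1)
      else if v = 3 then matching_projection (odd_match d) (odd_weight \<theta> d) 1
      else if v = 4 then matching_projection (odd_match d) (odd_weight \<theta> d) (- 1)
      else matching_projection (\<lambda>r. r) (jump \<theta>) 1)"

section \<open>The five matrices are projections\<close>

lemma frac_bounds: "0 \<le> frac (x :: real)" "frac x \<le> 1"
  using frac_ge_0[of x] frac_lt_1[of x] by simp_all

lemma even_weight_bounds: "0 \<le> even_weight \<theta> r" "even_weight \<theta> r \<le> 1"
  unfolding even_weight_def
  by (simp_all add: frac_bounds order_trans[OF frac_bounds(2)])

lemma odd_weight_bounds: "0 \<le> odd_weight \<theta> d r" "odd_weight \<theta> d r \<le> 1"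
  unfolding odd_weight_def
  by (simp_all add: frac_bounds order_trans[OF frac_bounds(2)])

text \<open>A step of length \<theta> < 1 passes at most one integer; this makes the diagonal matrix
  of jumps a projection.\<close>

lemma jump_cases:
  assumes "0 < \<theta>" "\<theta> < 1"
  shows "jump \<theta> r \<in> {0, 1}"
proof -
  have "\<lfloor>r * \<theta>\<rfloor> - \<lfloor>r * \<theta> - \<theta>\<rfloor> = 0 \<or> \<lfloor>r * \<theta>\<rfloor> - \<lfloor>r * \<theta> - \<theta>\<rfloor> = 1"
    using assms by linarith
  then show ?thesis unfolding jump_def by auto
qed

text \<open>For even \<open>d\<close> the pairs {0, 1}, {2, 3}, ... exhaust the indices, while {1,
  2}, {3, 4}, ... leave out just the two ends, where the weight 0 is admissible.\<close>

lemma five_projections_projection: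
  assumes "0 < \<theta>" "\<theta> < 1" and d: "even d"
  shows "real_projection d (five_projections \<theta> d v)"
proof -
  have E: "real_projection d (matching_projection even_match (even_weight \<theta>) e)" if "e * e = 1" for e
  proof (rule matching_projection)
    fix r assume r: "r < d"
    have "even r \<Longrightarrow> r + 1 \<noteq> d" using d by auto
    then show "even_match r < d" using r by (auto simp: even_match_def)
    show "even_match (even_match r) = r" by (auto simp: even_match_def elim: oddE)
    show "0 \<le> even_weight \<theta> r" "even_weight \<theta> r \<le> 1" by (rule even_weight_bounds)+
    show "even_weight \<theta> (even_match r) = 1 - even_weight \<theta> r"
      by (auto simp: even_weight_def even_match_def elim: oddE)
    show "even_weight \<theta> r \<in> {0, 1}" if "even_match r = r"
      using that by (auto simp: even_match_def elim: oddE split: if_splits)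
  qed fact
  have O: "real_projection d (matching_projection (odd_match d) (odd_weight \<theta> d) e)" if "e * e = 1" for e
  proof (rule matching_projection)
    fix r assume r: "r < d"
    show "odd_match d r < d" using r by (auto simp: odd_match_def)
    \<comment> \<open>Parity excludes \<open>r + 2 = d\<close>, so the partner of an odd interior
      index is not the fixed last index.\<close>
    have up: "r + 1 < d - 1" if "odd r" "r \<noteq> d - 1"
    proof -
      have "r + 2 \<noteq> d" using that(1) d by auto
      moreover have "r + 1 \<noteq> d" using that(2) by auto
      ultimately show ?thesis using r by linarith
    qed
    have down: "r - 1 \<noteq> 0" "r - 1 \<noteq> d - 1" "odd (r - 1)" if "even r" "r \<noteq> 0"
      using that r by (auto elim!: evenE)
    show "odd_match d (odd_match d r) = r"
      using up down by (auto simp: odd_match_def)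
    show "0 \<le> odd_weight \<theta> d r" "odd_weight \<theta> d r \<le> 1" by (rule odd_weight_bounds)+
    show "odd_weight \<theta> d (odd_match d r) = 1 - odd_weight \<theta> d r" if "odd_match d r \<noteq> r"
      using that up down by (auto simp: odd_weight_def odd_match_def)
    show "odd_weight \<theta> d r \<in> {0, 1}" if "odd_match d r = r"
      using that up down by (auto simp: odd_weight_def odd_match_def split: if_splits)
  qed fact
  have I: "real_projection d (matching_projection (\<lambda>r. r) (jump \<theta>) 1)"
    using jump_cases[OF assms(1,2)] by (intro matching_projection) (auto, (metis order_refl zero_le_one)+)
  show ?thesis
    unfolding five_projections_def using E[of 1] E[of "- 1"] O[of 1] O[of "- 1"] I by auto
qed

section \<open>The sum of the five projections and its distance from a scalar\<close>

lemma exhaust_5: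
  fixes x :: 5
  shows "x = 1 \<or> x = 2 \<or> x = 3 \<or> x = 4 \<or> x = 5"
proof (induct x)
  case (of_int z)
  then have "z = 0 \<or> z = 1 \<or> z = 2 \<or> z = 3 \<or> z = 4" by fastforce
  then show ?case by auto
qed

lemma sum_5: "sum f (UNIV :: 5 set) = f 1 + f 2 + f 3 + f 4 + f 5"
proof -
  have UNIV_5: "UNIV = {1, 2, 3, 4, 5 :: 5}" using exhaust_5 by auto
  show ?thesis unfolding UNIV_5 by (simp add: ac_simps)
qed

text \<open>Opposite signs cancel the off-diagonal entries and double the weights; for the fifth
  matrix the square root is 0 because the jumps are 0 or 1.\<close>

lemma five_projections_sum:
  assumes "0 < \<theta>" "\<theta> < 1"
  shows "(\<Sum>v\<in>UNIV. five_projections \<theta> d v r s) =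
    of_bool (r = s) * (2 * even_weight \<theta> r + 2 * odd_weight \<theta> d r + jump \<theta> r)"
  unfolding sum_5 using jump_cases[OF assms, of r]
  by (auto simp: five_projections_def matching_projection_def)

text \<open>An interior index is the lower one of its pair in one matching and the upper one in the
  other. The two fractional parts then differ by \<theta> minus the jump.\<close>

lemma five_projections_diagonal:
  assumes "0 < r" "r < d - 1"
  shows "2 * even_weight \<theta> r + 2 * odd_weight \<theta> d r + jump \<theta> r = 2 + \<theta>"
proof -
  have "real (r - 1) * \<theta> = r * \<theta> - \<theta>" using assms(1) by (simp add: of_nat_diff algebra_simps)
  then have "2 * even_weight \<theta> r + 2 * odd_weight \<theta> d r = frac (r * \<theta>) + 2 - frac (r * \<theta> - \<theta>)"
    using assms by (simp add: even_weight_def odd_weight_def)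
  then show ?thesis by (simp add: jump_def frac_def)
qed

text \<open>Only the two end rows can miss the value \<open>2 + \<theta>\<close>, each contributing
  at most 25. The bound is independent of \<open>d\<close>, so it tends to 0 after division by the
  dimension.\<close>

lemma five_projections_defect:
  assumes "0 < \<theta>" "\<theta> < 1"
  shows "(\<Sum>r<d. \<Sum>s<d. ((\<Sum>v\<in>UNIV. five_projections \<theta> d v r s) - (2 + \<theta>) * of_bool (r = s))\<^sup>2) \<le> 50"
proof -
  have "(\<Sum>r<d. \<Sum>s<d. ((\<Sum>v\<in>UNIV. five_projections \<theta> d v r s) - (2 + \<theta>) * of_bool (r = s))\<^sup>2)
      \<le> (\<Sum>r<d. if r \<in> {0, d - 1} then 25 else 0)"
  proof (rule sum_mono)
    fix r assume "r \<in> {..<d}"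
    then have r: "r < d" by simp
    define x where "x = 2 * even_weight \<theta> r + 2 * odd_weight \<theta> d r + jump \<theta> r"
    have "(\<Sum>s<d. ((\<Sum>v\<in>UNIV. five_projections \<theta> d v r s) - (2 + \<theta>) * of_bool (r = s))\<^sup>2)
        = (\<Sum>s<d. if s = r then (x - (2 + \<theta>))\<^sup>2 else 0)"
      unfolding five_projections_sum[OF assms] x_def by (intro sum.cong refl) auto
    also have "\<dots> = (x - (2 + \<theta>))\<^sup>2" using r by simp
    also have "\<dots> \<le> (if r \<in> {0, d - 1} then 25 else 0)"
    proof (cases "r \<in> {0, d - 1}")
      case True
      \<comment> \<open>The doubled weights contribute at most 4 and the jump at most 1, whereas
        \<open>2 + \<theta>\<close> lies between 2 and 3.\<close>
      have "0 \<le> x" "x \<le> 5"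
        using even_weight_bounds[of \<theta> r] odd_weight_bounds[of \<theta> d r] jump_cases[OF assms, of r]
        unfolding x_def by auto
      then have "\<bar>x - (2 + \<theta>)\<bar> \<le> 5" using assms by linarith
      then have "(x - (2 + \<theta>))\<^sup>2 \<le> 5\<^sup>2"
        using abs_le_square_iff[of "x - (2 + \<theta>)" 5] by simp
      then show ?thesis using True by simp
    next
      case False
      then have "x = 2 + \<theta>" unfolding x_def using r by (intro five_projections_diagonal) auto
      then show ?thesis using False by simp
    qed
    finally show "(\<Sum>s<d. ((\<Sum>v\<in>UNIV. five_projections \<theta> d v r s) - (2 + \<theta>) * of_bool (r = s))\<^sup>2)
      \<le> (if r \<in> {0, d - 1} then 25 else 0)" .
  qed
  also have "\<dots> = 25 * real (card ({..<d} \<inter> {0, d - 1}))"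
    by (simp add: sum.If_cases Collect_mem_eq del: insert_iff)
  also have "card ({..<d} \<inter> {0, d - 1}) \<le> card {0, d - 1}"
    by (intro card_mono) auto
  then have "25 * real (card ({..<d} \<inter> {0, d - 1})) \<le> 50"
    using card_insert_le_m1[of 2 "{d - 1}" 0] by simp
  finally show ?thesis .
qed

section \<open>Failure of closedness\<close>

theorem theorem4p2:
  shows "\<not> closed (synchronous_quantum_correlations :: (real ^ (2 \<times> 2 \<times> 5 \<times> 5)) set)"
proof
  assume closed: "closed (synchronous_quantum_correlations :: (real ^ (2 \<times> 2 \<times> 5 \<times> 5)) set)"
  have "uncountable ({0 <..< 1 :: real} - \<rat>)"
    using countable_rat by (intro uncountable_minus_countable) (auto simp: uncountable_open_interval)
  then obtain \<theta> :: real where \<theta>: "0 < \<theta>" "\<theta> < 1" "\<theta> \<notin> \<rat>"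
    by (metis DiffE all_not_in_conv countable_empty greaterThanLessThan_iff)
  \<comment> \<open>Intersecting with the cube gives compactness, so that a continuous function
    attains its minimum; all approximating correlations lie in the cube.\<close>
  define T where "T = (synchronous_quantum_correlations :: (real ^ (2 \<times> 2 \<times> 5 \<times> 5)) set) \<inter> {x. \<forall>k. \<bar>vec_nth x k\<bar> \<le> 1}"
  define f where "f p = (\<Sum>v\<in>UNIV. \<Sum>w\<in>UNIV. vec_nth p (1, 1, v, w))
     - 2 * (2 + \<theta>) * (\<Sum>v\<in>UNIV. vec_nth p (1, 1, v, v)) + (2 + \<theta>)\<^sup>2" for p :: "real ^ (2 \<times> 2 \<times> 5 \<times> 5)"
  have "{x :: real ^ (2 \<times> 2 \<times> 5 \<times> 5). \<forall>k. \<bar>vec_nth x k\<bar> \<le> 1} = cbox (vec_lambda (\<lambda>_. - 1)) (vec_lambda (\<lambda>_. 1))"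
    by (auto simp: mem_box_cart abs_le_iff)
  then have "compact T"
    unfolding T_def by (simp add: closed_Int_compact[OF closed])
  \<comment> \<open>The dimension \<open>2 * Suc m\<close> is even, as the matchings require, and
    positive, as a unit vector requires.\<close>
  define q where "q m = tracial_correlation (2 * Suc m) (five_projections \<theta> (2 * Suc m))" for m
  have proj: "real_projection (2 * Suc m) (five_projections \<theta> (2 * Suc m) v)" for m v
    by (rule five_projections_projection[OF \<theta>(1,2)]) simp
  have qT: "q m \<in> T" for m
    using tracial_correlation_quantum[OF proj] tracial_correlation_bound[OF proj]
    unfolding T_def q_def by auto
  have fq: "f (q m) \<le> 25 / Suc m" for m
  proof -
    have "f (q m) \<le> 50 / real (2 * Suc m)"
      unfolding f_def q_def tracial_correlation_defect[OF proj zero_less_Suc[THEN mult_pos_pos[OF zero_less_numeral]]]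
      by (intro divide_right_mono five_projections_defect \<theta>) simp
    also have "\<dots> = 25 / Suc m" by (simp add: field_simps)
    finally show ?thesis .
  qed
  have "continuous_on T f"
    unfolding f_def
    by (intro continuous_on_add continuous_on_diff continuous_on_mult continuous_on_sum
        continuous_on_const continuous_on_component continuous_on_id)
  moreover have "T \<noteq> {}" using qT by blast
  ultimately obtain p where p: "p \<in> T" "\<forall>x\<in>T. f p \<le> f x"
    using continuous_attains_inf[OF \<open>compact T\<close>] by meson
  \<comment> \<open>The minimum lies below \<open>f (q m) \<le> 25 / Suc m\<close> for every
    \<open>m\<close>, so the Archimedean property excludes a positive value.\<close>
  have "f p \<le> 0"
  proof (rule ccontr)
    assume "\<not> f p \<le> 0"
    then obtain m where "inverse (real (Suc m)) < f p / 25"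
      using reals_Archimedean[of "f p / 25"] by auto
    then have "25 / Suc m < f p" by (simp add: inverse_eq_divide)
    moreover have "f p \<le> f (q m)" using p(2) qT by blast
    ultimately show False using fq[of m] by linarith
  qed
  then have "2 + \<theta> \<in> \<rat>"
    using synchronous_quantum_correlation_rational[of p "2 + \<theta>"] p(1) unfolding f_def T_def by blast
  then have "2 + \<theta> - 2 \<in> \<rat>" by (intro Rats_diff) auto
  with \<theta>(3) show False by simp
qed

end
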